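(* For every universe level $a$, the type $$\mathsf{Funext}\,a\,a\to\mathsf{[]\text{-}cong\text{-}axiomatisation}\,a$$ is inhabited, where $\mathsf{[]\text{-}cong\text{-}axiomatisation}\,a$ denotes any of the ten (logically equivalent) types listed in the context.
   Context: The setting is Agda with erasure annotations and with the K rule turned off (no uniqueness of identity proofs, no erased matches for identity types assumed). $\mathsf{Type}\,a$ is the universe of types at level $a$. An argument marked $@0$ is erased: it may only be used in erased contexts (type signatures, erased arguments, bodies of erased definitions). $\{\ldots\}$ marks implicit arguments. $(x:A)\times P$ is the dependent pair type. $x\equiv y$ is the identity type $\mathsf{Id}\,A\,x\,y$, generated by $\mathsf{refl}$, with the usual J eliminator; $\mathsf{cong}\,f:x\equiv y\to f\,x\equiv f\,y$. $\mathsf{Erased}\,(@0\ A:\mathsf{Type}\,a):\mathsf{Type}\,a$ is the data type (no $\eta$) with the single constructor $[\_]:@0\ A\to\mathsf{Erased}\,A$; it comes with the erased projection $@0\ \mathsf{erased}:\mathsf{Erased}\,A\to A$, $\mathsf{erased}\,[x]=x$. $\mathsf{Is\text{-}equivalence}\,f$ is the usual homotopy-type-theoretic notion of equivalence. $\mathsf{Funext}\,a\,p$ (non-erased function extensionality) states that for all $A:\mathsf{Type}\,a$, $P:A\to\mathsf{Type}\,p$, $f,g:(x:A)\to P\,x$ the canonical map $f\equiv g\to(\forall x\to f\,x\equiv g\,x)$ is an equivalence. Extendability: for $f:A\to B$ and $P:B\to\mathsf{Type}\,c$, "$P$ is $0$-extendable along $f$" is the (lifted) unit type; "$P$ is $(1+n)$-extendable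 along $f$" is $\big((g:\forall x\to P\,(f\,x))\to(h:\forall x\to P\,x)\times(\forall x\to h\,(f\,x)\equiv g\,x)\big)\times\big((g\ h:\forall x\to P\,x)\to(\lambda x\to g\,x\equiv h\,x)\text{ is }n\text{-extendable along }f\big)$. $\mathsf{Is\text{-}\infty\text{-}extendable\text{-}along\text{-}}[f]\,P$ means that $P$ is $n$-extendable along $f$ for every $n:\mathbb N$. Further definitions: $\mathsf{Stable\text{-}equality^E}\,A=(x\ y:A)\to\mathsf{Erased}\,(x\equiv y)\to x\equiv y$; $\mathsf{Modal^E}\,A=\mathsf{Is\text{-}equivalence}\,(\lambda(x:A)\to[x])$; $\mathsf{Separated^E}\,A=(x\ y:A)\to\mathsf{Modal^E}\,(x\equiv y)$. The ten types: (1) $\big([]\text{-}cong:\{@0\ A:\mathsf{Type}\,a\}\,\{@0\ x\ y:A\}\to @0\ x\equiv y\to[x]\equiv[y]\big)\times\big(\{@0\ A:\mathsf{Type}\,a\}\,\{@0\ x:A\}\to[]\text{-}cong\,(\mathsf{refl}\,\{x=x\})\equiv\mathsf{refl}\big)$; (2) $\big([]\text{-}cong:\{A:\mathsf{Type}\,a\}\,\{x\ y:A\}\to @0\ x\equiv y\to[x]\equiv[y]\big)\times\big(\{A:\mathsf{Type}\,a\}\,\{x:A\}\to[]\text{-}cong\,(\mathsf{refl}\,\{x=x\})\equiv\mathsf{refl}\big)$; (3) $\big(f:\{@0\ A:\mathsf{Type}\,a\}\to\mathsf{Stable\text{-}equality^E}\,(\mathsf{Erased}\,A)\big)\times\big(\{@0\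 A:\mathsf{Type}\,a\}\,\{x:\mathsf{Erased}\,A\}\to f\,x\,x\,[\mathsf{refl}]\equiv\mathsf{refl}\big)$; (4) $\{@0\ A:\mathsf{Type}\,a\}\,\{@0\ x\ y:A\}\to\mathsf{Is\text{-}equivalence}\,(\lambda(eq:[x]\equiv[y])\to[\mathsf{cong}\ \mathsf{erased}\ eq])$; (5) $\{@0\ A:\mathsf{Type}\,a\}\,\{x\ y:\mathsf{Erased}\,A\}\to\mathsf{Is\text{-}equivalence}\,(\lambda(eq:x\equiv y)\to[\mathsf{cong}\ \mathsf{erased}\ eq])$; (6) $\{@0\ A:\mathsf{Type}\,a\}\to\mathsf{Separated^E}\,(\mathsf{Erased}\,A)$; (7) $\big(\{@0\ A:\mathsf{Type}\,a\}\to\mathsf{Modal^E}\,(\mathsf{Erased}\,A)\big)\times\big(\{A:\mathsf{Type}\,a\}\to\mathsf{Modal^E}\,A\to\mathsf{Separated^E}\,A\big)$; (8) $\big(subst^E:\{@0\ A:\mathsf{Type}\,a\}\,\{@0\ x\ y:A\}\,(P:@0\ A\to\mathsf{Type}\,a)\to @0\ x\equiv y\to P\,x\to P\,y\big)\times\big(\{@0\ A:\mathsf{Type}\,a\}\,\{@0\ x:A\}\,\{P:@0\ A\to\mathsf{Type}\,a\}\,\{p:P\,x\}\to subst^E\,P\,\mathsf{refl}\,p\equiv p\big)$; (9) $\big(J^E:\{@0\ A:\mathsf{Type}\,a\}\,\{@0\ x\ y:A\}\,(P:\{@0\ y:A\}\to @0\ x\equiv y\to\mathsf{Type}\,a)\to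 P\,\mathsf{refl}\to(@0\ eq:x\equiv y)\to P\,eq\big)\times\big(\{@0\ A:\mathsf{Type}\,a\}\,\{@0\ x:A\}\,\{P:\{@0\ y:A\}\to @0\ x\equiv y\to\mathsf{Type}\,a\}\,(r:P\,\mathsf{refl})\to J^E\,P\,r\,\mathsf{refl}\equiv r\big)$; (10) $\{A\ B:\mathsf{Type}\,a\}\to\mathsf{Is\text{-}\infty\text{-}extendable\text{-}along\text{-}}[\lambda x\to[x]]\,(\lambda(\_:\mathsf{Erased}\,A)\to\mathsf{Erased}\,B)$. *)

theory Defs
  imports Main
begin

text \<open>
  A deep embedding of the fragment of Agda (without K, without erased matches for identity types)
  that is needed to talk about erasure: a predicative, non-cumulative hierarchy of universes,
  dependent functions whose argument is either erased or not, strong dependent pairs, (lifted) unit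
  types, natural numbers, identity types with J, and the data type Erased.

  As usual for graded type theories, typing and erasure are separated. The typing relation makes
  sure that the annotations on binders and applications match, but does not restrict the use of
  variables. The predicate \<open>erasure_ok\<close> checks that a term does not use an erased variable in a
  non-erased position. Types occurring to the right of the colon are erased contexts, so
  \<open>erasure_ok\<close> is only imposed on the term.
\<close>

section \<open>Syntax\<close>

text \<open>
  Universe levels may contain variables: a statement about all level expressions includes the
  level-polymorphic statement (take a variable) as well as its instances.
\<close>

datatype level = LVar nat | LZero | LSuc level | LMax level level

primrec level_val :: "(nat \<Rightarrow> nat) \<Rightarrow> level \<Rightarrow> nat" where
  "level_val v (LVar i) = v i"
| "level_val v LZero = 0"
| "level_val v (LSuc l) = Suc (level_val v l)"
| "level_val v (LMax k l) = max (level_val v k) (level_val v l)"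

definition level_eq :: "level \<Rightarrow> level \<Rightarrow> bool" where
  "level_eq k l \<longleftrightarrow> (\<forall>v. level_val v k = level_val v l)"

datatype quantity = Erasd | Present

text \<open>
  Terms use de Bruijn indices. Binding structure: the last argument of \<open>Pi\<close> and \<open>Sig\<close> and
  the argument of \<open>Lam\<close> bind one variable; in \<open>Natrec C z s n\<close> the motive \<open>C\<close> binds one variable
  and \<open>s\<close> binds two (index 1: the predecessor, index 0: the recursive result);
  in \<open>J A t C u v e\<close> the motive \<open>C\<close> binds two (index 1: the right end point, index 0: the
  identity proof); in \<open>Unbox C b z\<close> (pattern matching on \<open>z\<close> of type Erased) both the motive \<open>C\<close>
  and the branch \<open>b\<close> bind one. The type arguments of \<open>Rfl\<close> and \<open>Box\<close> are data type
  parameters, and not stored. \<open>Unit l\<close> is the unit type lifted to level \<open>l\<close>.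
\<close>

datatype tm =
    Var nat
  | Univ level
  | Pi quantity tm tm | Lam quantity tm | App quantity tm tm
  | Sig tm tm | MkSig tm tm | Fst tm | Snd tm
  | Unit level | Star
  | Nat | Zero | Succ tm | Natrec tm tm tm tm
  | Eq tm tm tm | Rfl | J tm tm tm tm tm tm
  | Erased tm | Box tm | Unbox tm tm tm

definition up_ren :: "(nat \<Rightarrow> nat) \<Rightarrow> nat \<Rightarrow> nat" where
  "up_ren r = case_nat 0 (\<lambda>i. Suc (r i))"

primrec ren :: "(nat \<Rightarrow> nat) \<Rightarrow> tm \<Rightarrow> tm" where
  "ren r (Var i) = Var (r i)"
| "ren r (Univ l) = Univ l"
| "ren r (Pi q A B) = Pi q (ren r A) (ren (up_ren r) B)"
| "ren r (Lam q t) = Lam q (ren (up_ren r) t)"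
| "ren r (App q t u) = App q (ren r t) (ren r u)"
| "ren r (Sig A B) = Sig (ren r A) (ren (up_ren r) B)"
| "ren r (MkSig t u) = MkSig (ren r t) (ren r u)"
| "ren r (Fst t) = Fst (ren r t)"
| "ren r (Snd t) = Snd (ren r t)"
| "ren r (Unit l) = Unit l"
| "ren r Star = Star"
| "ren r Nat = Nat"
| "ren r Zero = Zero"
| "ren r (Succ t) = Succ (ren r t)"
| "ren r (Natrec C z s n) =
    Natrec (ren (up_ren r) C) (ren r z) (ren (up_ren (up_ren r)) s) (ren r n)"
| "ren r (Eq A t u) = Eq (ren r A) (ren r t) (ren r u)"
| "ren r Rfl = Rfl"
| "ren r (J A t C u v e) =
    J (ren r A) (ren r t) (ren (up_ren (up_ren r)) C) (ren r u) (ren r v) (ren r e)"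
| "ren r (Erased A) = Erased (ren r A)"
| "ren r (Box t) = Box (ren r t)"
| "ren r (Unbox C b z) = Unbox (ren (up_ren r) C) (ren (up_ren r) b) (ren r z)"

abbreviation lift :: "tm \<Rightarrow> tm" where
  "lift \<equiv> ren Suc"

definition up :: "(nat \<Rightarrow> tm) \<Rightarrow> nat \<Rightarrow> tm" where
  "up \<sigma> = case_nat (Var 0) (\<lambda>i. lift (\<sigma> i))"

primrec sub :: "(nat \<Rightarrow> tm) \<Rightarrow> tm \<Rightarrow> tm" where
  "sub \<sigma> (Var i) = \<sigma> i"
| "sub \<sigma> (Univ l) = Univ l"
| "sub \<sigma> (Pi q A B) = Pi q (sub \<sigma> A) (sub (up \<sigma>) B)"
| "sub \<sigma> (Lam q t) = Lam q (sub (up \<sigma>) t)"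
| "sub \<sigma> (App q t u) = App q (sub \<sigma> t) (sub \<sigma> u)"
| "sub \<sigma> (Sig A B) = Sig (sub \<sigma> A) (sub (up \<sigma>) B)"
| "sub \<sigma> (MkSig t u) = MkSig (sub \<sigma> t) (sub \<sigma> u)"
| "sub \<sigma> (Fst t) = Fst (sub \<sigma> t)"
| "sub \<sigma> (Snd t) = Snd (sub \<sigma> t)"
| "sub \<sigma> (Unit l) = Unit l"
| "sub \<sigma> Star = Star"
| "sub \<sigma> Nat = Nat"
| "sub \<sigma> Zero = Zero"
| "sub \<sigma> (Succ t) = Succ (sub \<sigma> t)"
| "sub \<sigma> (Natrec C z s n) =
    Natrec (sub (up \<sigma>) C) (sub \<sigma> z) (sub (up (up \<sigma>)) s) (sub \<sigma> n)"
| "sub \<sigma> (Eq A t u) = Eq (sub \<sigma> A) (sub \<sigma> t) (sub \<sigma> u)"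
| "sub \<sigma> Rfl = Rfl"
| "sub \<sigma> (J A t C u v e) =
    J (sub \<sigma> A) (sub \<sigma> t) (sub (up (up \<sigma>)) C) (sub \<sigma> u) (sub \<sigma> v) (sub \<sigma> e)"
| "sub \<sigma> (Erased A) = Erased (sub \<sigma> A)"
| "sub \<sigma> (Box t) = Box (sub \<sigma> t)"
| "sub \<sigma> (Unbox C b z) = Unbox (sub (up \<sigma>) C) (sub (up \<sigma>) b) (sub \<sigma> z)"

abbreviation sub1 :: "tm \<Rightarrow> tm \<Rightarrow> tm" where
  "sub1 t a \<equiv> sub (case_nat a Var) t"

text \<open>In \<open>sub2 t a b\<close> index 1 is replaced by \<open>a\<close> and index 0 by \<open>b\<close>.\<close>

abbreviation sub2 :: "tm \<Rightarrow> tm \<Rightarrow> tm \<Rightarrow> tm" where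
  "sub2 t a b \<equiv> sub (case_nat b (case_nat a Var)) t"

section \<open>Beta conversion\<close>

text \<open>
  Conversion of raw terms. An application only reduces if the two annotations agree. There is no
  \<open>\<eta>\<close> here: \<open>\<eta>\<close> for functions, pairs and the unit type is part of typed equality below, and
  Erased has no \<open>\<eta>\<close>.
\<close>

inductive beta_conv :: "tm \<Rightarrow> tm \<Rightarrow> bool" (infix "\<approx>\<^sub>\<beta>" 50) where
  bc_refl: "t \<approx>\<^sub>\<beta> t"
| bc_sym: "t \<approx>\<^sub>\<beta> u \<Longrightarrow> u \<approx>\<^sub>\<beta> t"
| bc_trans: "t \<approx>\<^sub>\<beta> u \<Longrightarrow> u \<approx>\<^sub>\<beta> v \<Longrightarrow> t \<approx>\<^sub>\<beta> v"
| bc_app_lam: "App q (Lam q t) u \<approx>\<^sub>\<beta> sub1 t u"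
| bc_fst_pair: "Fst (MkSig t u) \<approx>\<^sub>\<beta> t"
| bc_snd_pair: "Snd (MkSig t u) \<approx>\<^sub>\<beta> u"
| bc_natrec_zero: "Natrec C z s Zero \<approx>\<^sub>\<beta> z"
| bc_natrec_succ: "Natrec C z s (Succ n) \<approx>\<^sub>\<beta> sub2 s n (Natrec C z s n)"
| bc_J_rfl: "J A t C u v Rfl \<approx>\<^sub>\<beta> u"
| bc_unbox_box: "Unbox C b (Box t) \<approx>\<^sub>\<beta> sub1 b t"
| bc_univ: "level_eq k l \<Longrightarrow> Univ k \<approx>\<^sub>\<beta> Univ l"
| bc_unit: "level_eq k l \<Longrightarrow> Unit k \<approx>\<^sub>\<beta> Unit l"
| bc_pi: "A \<approx>\<^sub>\<beta> A' \<Longrightarrow> B \<approx>\<^sub>\<beta> B' \<Longrightarrow> Pi q A B \<approx>\<^sub>\<beta> Pi q A' B'"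
| bc_lam: "t \<approx>\<^sub>\<beta> t' \<Longrightarrow> Lam q t \<approx>\<^sub>\<beta> Lam q t'"
| bc_app: "t \<approx>\<^sub>\<beta> t' \<Longrightarrow> u \<approx>\<^sub>\<beta> u' \<Longrightarrow> App q t u \<approx>\<^sub>\<beta> App q t' u'"
| bc_sig: "A \<approx>\<^sub>\<beta> A' \<Longrightarrow> B \<approx>\<^sub>\<beta> B' \<Longrightarrow> Sig A B \<approx>\<^sub>\<beta> Sig A' B'"
| bc_pair: "t \<approx>\<^sub>\<beta> t' \<Longrightarrow> u \<approx>\<^sub>\<beta> u' \<Longrightarrow> MkSig t u \<approx>\<^sub>\<beta> MkSig t' u'"
| bc_fst: "t \<approx>\<^sub>\<beta> t' \<Longrightarrow> Fst t \<approx>\<^sub>\<beta> Fst t'"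
| bc_snd: "t \<approx>\<^sub>\<beta> t' \<Longrightarrow> Snd t \<approx>\<^sub>\<beta> Snd t'"
| bc_succ: "t \<approx>\<^sub>\<beta> t' \<Longrightarrow> Succ t \<approx>\<^sub>\<beta> Succ t'"
| bc_natrec: "C \<approx>\<^sub>\<beta> C' \<Longrightarrow> z \<approx>\<^sub>\<beta> z' \<Longrightarrow> s \<approx>\<^sub>\<beta> s' \<Longrightarrow> n \<approx>\<^sub>\<beta> n' \<Longrightarrow>
    Natrec C z s n \<approx>\<^sub>\<beta> Natrec C' z' s' n'"
| bc_eq: "A \<approx>\<^sub>\<beta> A' \<Longrightarrow> t \<approx>\<^sub>\<beta> t' \<Longrightarrow> u \<approx>\<^sub>\<beta> u' \<Longrightarrow> Eq A t u \<approx>\<^sub>\<beta> Eq A' t' u'"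
| bc_J: "A \<approx>\<^sub>\<beta> A' \<Longrightarrow> t \<approx>\<^sub>\<beta> t' \<Longrightarrow> C \<approx>\<^sub>\<beta> C' \<Longrightarrow> u \<approx>\<^sub>\<beta> u' \<Longrightarrow> v \<approx>\<^sub>\<beta> v' \<Longrightarrow> e \<approx>\<^sub>\<beta> e' \<Longrightarrow>
    J A t C u v e \<approx>\<^sub>\<beta> J A' t' C' u' v' e'"
| bc_erased: "A \<approx>\<^sub>\<beta> A' \<Longrightarrow> Erased A \<approx>\<^sub>\<beta> Erased A'"
| bc_box: "t \<approx>\<^sub>\<beta> t' \<Longrightarrow> Box t \<approx>\<^sub>\<beta> Box t'"
| bc_unbox: "C \<approx>\<^sub>\<beta> C' \<Longrightarrow> b \<approx>\<^sub>\<beta> b' \<Longrightarrow> z \<approx>\<^sub>\<beta> z' \<Longrightarrow> Unbox C b z \<approx>\<^sub>\<beta> Unbox C' b' z'"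

section \<open>Typing and typed equality\<close>

text \<open>
  The head of a context is the type of the variable with index 0. There is no separate judgement
  for well-formed contexts: every rule that extends a context has a premise which guarantees that
  the new type is well-formed, and the empty context is the starting point.

  Equality contains \<open>\<beta>\<close>-conversion between well-typed terms. The rules \<open>eq_fun\<close>, \<open>eq_pair\<close> and
  \<open>eq_unit\<close> are \<open>\<eta>\<close> for functions, pairs and unit types, the rule \<open>eq_subst\<close> gives congruence for
  arguments under which nothing is bound, and the remaining rules give congruence for binders.
  The rule \<open>t_conv_beta\<close> differs from an instance of \<open>t_conv\<close> only in not requiring a derivation
  showing that \<open>A\<close> is well-formed.
\<close>

inductive
  typing :: "tm list \<Rightarrow> tm \<Rightarrow> tm \<Rightarrow> bool" ("_ \<turnstile> _ \<^bold>: _" [51, 51, 51] 50) and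
  tm_eq :: "tm list \<Rightarrow> tm \<Rightarrow> tm \<Rightarrow> tm \<Rightarrow> bool" ("_ \<turnstile> _ \<doteq> _ \<^bold>: _" [51, 51, 51, 51] 50)
where
  t_var: "i < length \<Gamma> \<Longrightarrow> \<Gamma> \<turnstile> Var i \<^bold>: ren (\<lambda>j. j + Suc i) (\<Gamma> ! i)"
| t_univ: "\<Gamma> \<turnstile> Univ l \<^bold>: Univ (LSuc l)"
| t_pi: "\<Gamma> \<turnstile> A \<^bold>: Univ k \<Longrightarrow> A # \<Gamma> \<turnstile> B \<^bold>: Univ l \<Longrightarrow> \<Gamma> \<turnstile> Pi q A B \<^bold>: Univ (LMax k l)"
| t_lam: "\<Gamma> \<turnstile> A \<^bold>: Univ k \<Longrightarrow> A # \<Gamma> \<turnstile> t \<^bold>: B \<Longrightarrow> \<Gamma> \<turnstile> Lam q t \<^bold>: Pi q A B"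
| t_app: "\<Gamma> \<turnstile> t \<^bold>: Pi q A B \<Longrightarrow> \<Gamma> \<turnstile> u \<^bold>: A \<Longrightarrow> \<Gamma> \<turnstile> App q t u \<^bold>: sub1 B u"
| t_sig: "\<Gamma> \<turnstile> A \<^bold>: Univ k \<Longrightarrow> A # \<Gamma> \<turnstile> B \<^bold>: Univ l \<Longrightarrow> \<Gamma> \<turnstile> Sig A B \<^bold>: Univ (LMax k l)"
| t_pair: "\<Gamma> \<turnstile> A \<^bold>: Univ k \<Longrightarrow> A # \<Gamma> \<turnstile> B \<^bold>: Univ l \<Longrightarrow> \<Gamma> \<turnstile> t \<^bold>: A \<Longrightarrow> \<Gamma> \<turnstile> u \<^bold>: sub1 B t \<Longrightarrow>
    \<Gamma> \<turnstile> MkSig t u \<^bold>: Sig A B"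
| t_fst: "\<Gamma> \<turnstile> t \<^bold>: Sig A B \<Longrightarrow> \<Gamma> \<turnstile> Fst t \<^bold>: A"
| t_snd: "\<Gamma> \<turnstile> t \<^bold>: Sig A B \<Longrightarrow> \<Gamma> \<turnstile> Snd t \<^bold>: sub1 B (Fst t)"
| t_unit: "\<Gamma> \<turnstile> Unit l \<^bold>: Univ l"
| t_star: "\<Gamma> \<turnstile> Star \<^bold>: Unit l"
| t_nat: "\<Gamma> \<turnstile> Nat \<^bold>: Univ LZero"
| t_zero: "\<Gamma> \<turnstile> Zero \<^bold>: Nat"
| t_succ: "\<Gamma> \<turnstile> t \<^bold>: Nat \<Longrightarrow> \<Gamma> \<turnstile> Succ t \<^bold>: Nat"
| t_natrec: "Nat # \<Gamma> \<turnstile> C \<^bold>: Univ l \<Longrightarrow> \<Gamma> \<turnstile> z \<^bold>: sub1 C Zero \<Longrightarrow>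
    C # Nat # \<Gamma> \<turnstile> s \<^bold>: sub (case_nat (Succ (Var 1)) (\<lambda>i. Var (i + 2))) C \<Longrightarrow> \<Gamma> \<turnstile> n \<^bold>: Nat \<Longrightarrow>
    \<Gamma> \<turnstile> Natrec C z s n \<^bold>: sub1 C n"
| t_eq: "\<Gamma> \<turnstile> A \<^bold>: Univ l \<Longrightarrow> \<Gamma> \<turnstile> t \<^bold>: A \<Longrightarrow> \<Gamma> \<turnstile> u \<^bold>: A \<Longrightarrow> \<Gamma> \<turnstile> Eq A t u \<^bold>: Univ l"
| t_rfl: "\<Gamma> \<turnstile> t \<^bold>: A \<Longrightarrow> \<Gamma> \<turnstile> Rfl \<^bold>: Eq A t t"
| t_J: "\<Gamma> \<turnstile> A \<^bold>: Univ k \<Longrightarrow> \<Gamma> \<turnstile> t \<^bold>: A \<Longrightarrow>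
    Eq (lift A) (lift t) (Var 0) # A # \<Gamma> \<turnstile> C \<^bold>: Univ l \<Longrightarrow> \<Gamma> \<turnstile> u \<^bold>: sub2 C t Rfl \<Longrightarrow>
    \<Gamma> \<turnstile> v \<^bold>: A \<Longrightarrow> \<Gamma> \<turnstile> e \<^bold>: Eq A t v \<Longrightarrow> \<Gamma> \<turnstile> J A t C u v e \<^bold>: sub2 C v e"
| t_erased: "\<Gamma> \<turnstile> A \<^bold>: Univ l \<Longrightarrow> \<Gamma> \<turnstile> Erased A \<^bold>: Univ l"
| t_box: "\<Gamma> \<turnstile> t \<^bold>: A \<Longrightarrow> \<Gamma> \<turnstile> Box t \<^bold>: Erased A"
| t_unbox: "\<Gamma> \<turnstile> A \<^bold>: Univ k \<Longrightarrow> Erased A # \<Gamma> \<turnstile> C \<^bold>: Univ l \<Longrightarrow>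
    A # \<Gamma> \<turnstile> b \<^bold>: sub (case_nat (Box (Var 0)) (\<lambda>i. Var (i + 1))) C \<Longrightarrow> \<Gamma> \<turnstile> z \<^bold>: Erased A \<Longrightarrow>
    \<Gamma> \<turnstile> Unbox C b z \<^bold>: sub1 C z"
| t_conv_beta: "\<Gamma> \<turnstile> t \<^bold>: A \<Longrightarrow> A \<approx>\<^sub>\<beta> B \<Longrightarrow> \<Gamma> \<turnstile> B \<^bold>: Univ l \<Longrightarrow> \<Gamma> \<turnstile> t \<^bold>: B"
| t_conv: "\<Gamma> \<turnstile> t \<^bold>: A \<Longrightarrow> \<Gamma> \<turnstile> A \<doteq> B \<^bold>: Univ l \<Longrightarrow> \<Gamma> \<turnstile> t \<^bold>: B"

| eq_beta: "\<Gamma> \<turnstile> t \<^bold>: A \<Longrightarrow> \<Gamma> \<turnstile> u \<^bold>: A \<Longrightarrow> t \<approx>\<^sub>\<beta> u \<Longrightarrow> \<Gamma> \<turnstile> t \<doteq> u \<^bold>: A"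
| eq_sym: "\<Gamma> \<turnstile> t \<doteq> u \<^bold>: A \<Longrightarrow> \<Gamma> \<turnstile> u \<doteq> t \<^bold>: A"
| eq_trans: "\<Gamma> \<turnstile> t \<doteq> u \<^bold>: A \<Longrightarrow> \<Gamma> \<turnstile> u \<doteq> v \<^bold>: A \<Longrightarrow> \<Gamma> \<turnstile> t \<doteq> v \<^bold>: A"
| eq_conv: "\<Gamma> \<turnstile> t \<doteq> u \<^bold>: A \<Longrightarrow> \<Gamma> \<turnstile> A \<doteq> B \<^bold>: Univ l \<Longrightarrow> \<Gamma> \<turnstile> t \<doteq> u \<^bold>: B"
| eq_fun: "\<Gamma> \<turnstile> t \<^bold>: Pi q A B \<Longrightarrow> \<Gamma> \<turnstile> u \<^bold>: Pi q A B \<Longrightarrow> \<Gamma> \<turnstile> A \<^bold>: Univ k \<Longrightarrow>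
    A # \<Gamma> \<turnstile> App q (lift t) (Var 0) \<doteq> App q (lift u) (Var 0) \<^bold>: B \<Longrightarrow> \<Gamma> \<turnstile> t \<doteq> u \<^bold>: Pi q A B"
| eq_pair: "\<Gamma> \<turnstile> t \<^bold>: Sig A B \<Longrightarrow> \<Gamma> \<turnstile> u \<^bold>: Sig A B \<Longrightarrow> \<Gamma> \<turnstile> Fst t \<doteq> Fst u \<^bold>: A \<Longrightarrow>
    \<Gamma> \<turnstile> Snd t \<doteq> Snd u \<^bold>: sub1 B (Fst t) \<Longrightarrow> \<Gamma> \<turnstile> t \<doteq> u \<^bold>: Sig A B"
| eq_unit: "\<Gamma> \<turnstile> t \<^bold>: Unit l \<Longrightarrow> \<Gamma> \<turnstile> u \<^bold>: Unit l \<Longrightarrow> \<Gamma> \<turnstile> t \<doteq> u \<^bold>: Unit l"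
| eq_subst: "\<Gamma> \<turnstile> A \<^bold>: Univ k \<Longrightarrow> \<Gamma> \<turnstile> t \<doteq> u \<^bold>: A \<Longrightarrow> A # \<Gamma> \<turnstile> s \<^bold>: B \<Longrightarrow>
    \<Gamma> \<turnstile> sub1 s t \<doteq> sub1 s u \<^bold>: sub1 B t"
| eq_pi: "\<Gamma> \<turnstile> A \<^bold>: Univ k \<Longrightarrow> A # \<Gamma> \<turnstile> B \<doteq> B' \<^bold>: Univ l \<Longrightarrow>
    \<Gamma> \<turnstile> A \<doteq> A' \<^bold>: Univ k \<Longrightarrow> \<Gamma> \<turnstile> Pi q A B \<doteq> Pi q A' B' \<^bold>: Univ (LMax k l)"
| eq_sig: "\<Gamma> \<turnstile> A \<^bold>: Univ k \<Longrightarrow> A # \<Gamma> \<turnstile> B \<doteq> B' \<^bold>: Univ l \<Longrightarrow>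
    \<Gamma> \<turnstile> A \<doteq> A' \<^bold>: Univ k \<Longrightarrow> \<Gamma> \<turnstile> Sig A B \<doteq> Sig A' B' \<^bold>: Univ (LMax k l)"
| eq_natrec: "Nat # \<Gamma> \<turnstile> C \<^bold>: Univ l \<Longrightarrow> Nat # \<Gamma> \<turnstile> C \<doteq> C' \<^bold>: Univ l \<Longrightarrow>
    \<Gamma> \<turnstile> z \<doteq> z' \<^bold>: sub1 C Zero \<Longrightarrow>
    C # Nat # \<Gamma> \<turnstile> s \<doteq> s' \<^bold>: sub (case_nat (Succ (Var 1)) (\<lambda>i. Var (i + 2))) C \<Longrightarrow>
    \<Gamma> \<turnstile> n \<doteq> n' \<^bold>: Nat \<Longrightarrow> \<Gamma> \<turnstile> Natrec C z s n \<doteq> Natrec C' z' s' n' \<^bold>: sub1 C n"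
| eq_J: "\<Gamma> \<turnstile> A \<^bold>: Univ k \<Longrightarrow> \<Gamma> \<turnstile> t \<^bold>: A \<Longrightarrow> \<Gamma> \<turnstile> A \<doteq> A' \<^bold>: Univ k \<Longrightarrow> \<Gamma> \<turnstile> t \<doteq> t' \<^bold>: A \<Longrightarrow>
    Eq (lift A) (lift t) (Var 0) # A # \<Gamma> \<turnstile> C \<doteq> C' \<^bold>: Univ l \<Longrightarrow> \<Gamma> \<turnstile> u \<doteq> u' \<^bold>: sub2 C t Rfl \<Longrightarrow>
    \<Gamma> \<turnstile> v \<doteq> v' \<^bold>: A \<Longrightarrow> \<Gamma> \<turnstile> e \<doteq> e' \<^bold>: Eq A t v \<Longrightarrow>
    \<Gamma> \<turnstile> J A t C u v e \<doteq> J A' t' C' u' v' e' \<^bold>: sub2 C v e"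
| eq_unbox: "\<Gamma> \<turnstile> A \<^bold>: Univ k \<Longrightarrow> Erased A # \<Gamma> \<turnstile> C \<doteq> C' \<^bold>: Univ l \<Longrightarrow>
    A # \<Gamma> \<turnstile> b \<doteq> b' \<^bold>: sub (case_nat (Box (Var 0)) (\<lambda>i. Var (i + 1))) C \<Longrightarrow>
    \<Gamma> \<turnstile> z \<doteq> z' \<^bold>: Erased A \<Longrightarrow> \<Gamma> \<turnstile> Unbox C b z \<doteq> Unbox C' b' z' \<^bold>: sub1 C z"

section \<open>Erasure\<close>

text \<open>
  \<open>erasure_ok \<rho> t\<close>: no variable marked as erased by \<open>\<rho>\<close> is used in a non-erased position of \<open>t\<close>.
  The erased positions are the arguments of erased applications, of Erased and of its constructor,
  and the motives of \<open>Natrec\<close> and \<open>Unbox\<close>, which play the role of the type signature of a function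
  defined by pattern matching. A match on a constructor of Erased binds an erased variable.

  There are no erased matches for identity types: all arguments of J count as non-erased.

  As in Agda, the variable bound by a function type is not erased in the codomain, even if the
  argument is.
\<close>

primrec erasure_ok :: "quantity list \<Rightarrow> tm \<Rightarrow> bool" where
  "erasure_ok \<rho> (Var i) \<longleftrightarrow> i < length \<rho> \<and> \<rho> ! i = Present"
| "erasure_ok \<rho> (Univ l) \<longleftrightarrow> True"
| "erasure_ok \<rho> (Pi q A B) \<longleftrightarrow> erasure_ok \<rho> A \<and> erasure_ok (Present # \<rho>) B"
| "erasure_ok \<rho> (Lam q t) \<longleftrightarrow> erasure_ok (q # \<rho>) t"
| "erasure_ok \<rho> (App q t u) \<longleftrightarrow> erasure_ok \<rho> t \<and> (q = Present \<longrightarrow> erasure_ok \<rho> u)"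
| "erasure_ok \<rho> (Sig A B) \<longleftrightarrow> erasure_ok \<rho> A \<and> erasure_ok (Present # \<rho>) B"
| "erasure_ok \<rho> (MkSig t u) \<longleftrightarrow> erasure_ok \<rho> t \<and> erasure_ok \<rho> u"
| "erasure_ok \<rho> (Fst t) \<longleftrightarrow> erasure_ok \<rho> t"
| "erasure_ok \<rho> (Snd t) \<longleftrightarrow> erasure_ok \<rho> t"
| "erasure_ok \<rho> (Unit l) \<longleftrightarrow> True"
| "erasure_ok \<rho> Star \<longleftrightarrow> True"
| "erasure_ok \<rho> Nat \<longleftrightarrow> True"
| "erasure_ok \<rho> Zero \<longleftrightarrow> True"
| "erasure_ok \<rho> (Succ t) \<longleftrightarrow> erasure_ok \<rho> t"
| "erasure_ok \<rho> (Natrec C z s n) \<longleftrightarrow>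
    erasure_ok \<rho> z \<and> erasure_ok (Present # Present # \<rho>) s \<and> erasure_ok \<rho> n"
| "erasure_ok \<rho> (Eq A t u) \<longleftrightarrow> erasure_ok \<rho> A \<and> erasure_ok \<rho> t \<and> erasure_ok \<rho> u"
| "erasure_ok \<rho> Rfl \<longleftrightarrow> True"
| "erasure_ok \<rho> (J A t C u v e) \<longleftrightarrow>
    erasure_ok \<rho> A \<and> erasure_ok \<rho> t \<and> erasure_ok (Present # Present # \<rho>) C \<and>
    erasure_ok \<rho> u \<and> erasure_ok \<rho> v \<and> erasure_ok \<rho> e"
| "erasure_ok \<rho> (Erased A) \<longleftrightarrow> True"
| "erasure_ok \<rho> (Box t) \<longleftrightarrow> True"
| "erasure_ok \<rho> (Unbox C b z) \<longleftrightarrow> erasure_ok (Erasd # \<rho>) b \<and> erasure_ok \<rho> z"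

section \<open>Notation with named variables\<close>

text \<open>
  To avoid de Bruijn indices in concrete types, these are written as functions from the number of
  enclosing binders to terms. A binder in scope of \<open>n\<close> binders hands a reference to its variable
  to its body; at a place in scope of \<open>k\<close> binders that variable has index \<open>k - Suc n\<close>. With this
  representation a definition can be applied in any scope without explicit weakening or capture.
  Closed terms are obtained by application to 0.

  Agda's implicit arguments are rendered as ordinary arguments with the same erasure annotation.
  The suffix 0 marks erased function types, functions and applications.
\<close>

type_synonym stm = "nat \<Rightarrow> tm"

definition vr :: "nat \<Rightarrow> stm" where
  "vr n = (\<lambda>k. Var (k - Suc n))"

definition bind :: "(stm \<Rightarrow> stm) \<Rightarrow> stm" where
  "bind f = (\<lambda>n. f (vr n) (Suc n))"

definition bind2 :: "(stm \<Rightarrow> stm \<Rightarrow> stm) \<Rightarrow> stm" where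
  "bind2 f = (\<lambda>n. f (vr n) (vr (Suc n)) (Suc (Suc n)))"

definition Type :: "level \<Rightarrow> stm" where
  "Type l = (\<lambda>n. Univ l)"
definition pi :: "stm \<Rightarrow> (stm \<Rightarrow> stm) \<Rightarrow> stm" where
  "pi A B = (\<lambda>n. Pi Present (A n) (bind B n))"
definition pi0 :: "stm \<Rightarrow> (stm \<Rightarrow> stm) \<Rightarrow> stm" where
  "pi0 A B = (\<lambda>n. Pi Erasd (A n) (bind B n))"
definition lam :: "(stm \<Rightarrow> stm) \<Rightarrow> stm" where
  "lam t = (\<lambda>n. Lam Present (bind t n))"
definition lam0 :: "(stm \<Rightarrow> stm) \<Rightarrow> stm" where
  "lam0 t = (\<lambda>n. Lam Erasd (bind t n))"
definition app :: "stm \<Rightarrow> stm \<Rightarrow> stm" (infixl "\<cdot>" 90) where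
  "t \<cdot> u = (\<lambda>n. App Present (t n) (u n))"
definition app0 :: "stm \<Rightarrow> stm \<Rightarrow> stm" (infixl "\<cdot>\<^sub>0" 90) where
  "t \<cdot>\<^sub>0 u = (\<lambda>n. App Erasd (t n) (u n))"
definition sigma :: "stm \<Rightarrow> (stm \<Rightarrow> stm) \<Rightarrow> stm" where
  "sigma A B = (\<lambda>n. Sig (A n) (bind B n))"
definition unit_type :: "level \<Rightarrow> stm" where
  "unit_type l = (\<lambda>n. Unit l)"
definition nat_type :: stm where
  "nat_type = (\<lambda>n. Nat)"
definition natrec :: "(stm \<Rightarrow> stm) \<Rightarrow> stm \<Rightarrow> (stm \<Rightarrow> stm \<Rightarrow> stm) \<Rightarrow> stm \<Rightarrow> stm" where
  "natrec C z s m = (\<lambda>n. Natrec (bind C n) (z n) (bind2 s n) (m n))"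
definition Id :: "stm \<Rightarrow> stm \<Rightarrow> stm \<Rightarrow> stm" where
  "Id A t u = (\<lambda>n. Eq (A n) (t n) (u n))"
definition refl :: stm where
  "refl = (\<lambda>n. Rfl)"
definition Jelim :: "stm \<Rightarrow> stm \<Rightarrow> (stm \<Rightarrow> stm \<Rightarrow> stm) \<Rightarrow> stm \<Rightarrow> stm \<Rightarrow> stm \<Rightarrow> stm" where
  "Jelim A t C u v e = (\<lambda>n. J (A n) (t n) (bind2 C n) (u n) (v n) (e n))"
definition Er :: "stm \<Rightarrow> stm" where
  "Er A = (\<lambda>n. Erased (A n))"
definition box :: "stm \<Rightarrow> stm" where
  "box t = (\<lambda>n. Box (t n))"
definition unbox :: "(stm \<Rightarrow> stm) \<Rightarrow> (stm \<Rightarrow> stm) \<Rightarrow> stm \<Rightarrow> stm" where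
  "unbox C b z = (\<lambda>n. Unbox (bind C n) (bind b n) (z n))"

abbreviation arrow :: "stm \<Rightarrow> stm \<Rightarrow> stm" (infixr "\<rightarrow>\<^sub>t" 60) where
  "A \<rightarrow>\<^sub>t B \<equiv> pi A (\<lambda>_. B)"
abbreviation arrow0 :: "stm \<Rightarrow> stm \<Rightarrow> stm" (infixr "\<rightarrow>\<^sub>0" 60) where
  "A \<rightarrow>\<^sub>0 B \<equiv> pi0 A (\<lambda>_. B)"
abbreviation times :: "stm \<Rightarrow> stm \<Rightarrow> stm" (infixr "\<times>\<^sub>t" 70) where
  "A \<times>\<^sub>t B \<equiv> sigma A (\<lambda>_. B)"

definition inhabited :: "stm \<Rightarrow> bool" where
  "inhabited T \<longleftrightarrow> (\<exists>t. [] \<turnstile> t \<^bold>: T 0 \<and> erasure_ok [] t)"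

section \<open>Derived notions\<close>

text \<open>
  This is only usable in erased positions: for \<open>z\<close> in \<open>Er A\<close> the term \<open>erased A z\<close> has type \<open>A\<close>,
  but its branch returns the erased variable bound by the match, so it is not \<open>erasure_ok\<close>.
\<close>

definition erased :: "stm \<Rightarrow> stm \<Rightarrow> stm" where
  "erased A z = unbox (\<lambda>_. A) (\<lambda>x. x) z"

definition cong :: "stm \<Rightarrow> stm \<Rightarrow> (stm \<Rightarrow> stm) \<Rightarrow> stm \<Rightarrow> stm \<Rightarrow> stm \<Rightarrow> stm" where
  "cong A B f x y eq = Jelim A x (\<lambda>z _. Id B (f x) (f z)) refl y eq"

text \<open>
  Half adjoint equivalences: an inverse \<open>g\<close>, homotopies \<open>r\<close> (right inverse) and \<open>l\<close> (left inverse),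
  and the coherence \<open>cong f (l x) = r (f x)\<close>.
\<close>

definition Is_equivalence :: "stm \<Rightarrow> stm \<Rightarrow> stm \<Rightarrow> stm" where
  "Is_equivalence A B f =
    sigma (B \<rightarrow>\<^sub>t A) (\<lambda>g.
    sigma (pi B (\<lambda>y. Id B (f \<cdot> (g \<cdot> y)) y)) (\<lambda>r.
    sigma (pi A (\<lambda>x. Id A (g \<cdot> (f \<cdot> x)) x)) (\<lambda>l.
    pi A (\<lambda>x. Id (Id B (f \<cdot> (g \<cdot> (f \<cdot> x))) (f \<cdot> x))
      (cong A B (\<lambda>z. f \<cdot> z) (g \<cdot> (f \<cdot> x)) x (l \<cdot> x))
      (r \<cdot> (f \<cdot> x))))))"

text \<open>The map that is required to be an equivalence sends \<open>eq\<close> and \<open>x\<close> to \<open>cong (\<lambda>h. h x) eq\<close>.\<close>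

definition Funext :: "level \<Rightarrow> level \<Rightarrow> stm" where
  "Funext a p =
    pi (Type a) (\<lambda>A. pi (A \<rightarrow>\<^sub>t Type p) (\<lambda>P.
    pi (pi A (\<lambda>x. P \<cdot> x)) (\<lambda>f. pi (pi A (\<lambda>x. P \<cdot> x)) (\<lambda>g.
    Is_equivalence
      (Id (pi A (\<lambda>x. P \<cdot> x)) f g)
      (pi A (\<lambda>x. Id (P \<cdot> x) (f \<cdot> x) (g \<cdot> x)))
      (lam (\<lambda>eq. lam (\<lambda>x. cong (pi A (\<lambda>x. P \<cdot> x)) (P \<cdot> x) (\<lambda>h. h \<cdot> x) f g eq)))))))"

definition Stable_equality_E :: "stm \<Rightarrow> stm" where
  "Stable_equality_E A = pi A (\<lambda>x. pi A (\<lambda>y. Er (Id A x y) \<rightarrow>\<^sub>t Id A x y))"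

definition Modal_E :: "stm \<Rightarrow> stm" where
  "Modal_E A = Is_equivalence A (Er A) (lam (\<lambda>x. box x))"

definition Separated_E :: "stm \<Rightarrow> stm" where
  "Separated_E A = pi A (\<lambda>x. pi A (\<lambda>y. Modal_E (Id A x y)))"

text \<open>
  For \<open>A\<close> in \<open>Type a\<close>, \<open>B\<close> in \<open>Type b\<close>, \<open>f\<close> in \<open>A \<rightarrow>\<^sub>t B\<close> and \<open>P\<close> in \<open>B \<rightarrow>\<^sub>t Type c\<close>: \<open>P\<close> is
  \<open>m\<close>-extendable along \<open>f\<close>. The recursion is on the object-level natural number \<open>m\<close>, with
  \<open>P\<close> varying.
\<close>

definition extendable :: "level \<Rightarrow> level \<Rightarrow> level \<Rightarrow> stm \<Rightarrow> stm \<Rightarrow> stm \<Rightarrow> stm \<Rightarrow> stm \<Rightarrow> stm" where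
  "extendable a b c A B m f P =
    natrec
      (\<lambda>_. (B \<rightarrow>\<^sub>t Type c) \<rightarrow>\<^sub>t Type (LMax a (LMax b c)))
      (lam (\<lambda>_. unit_type (LMax a (LMax b c))))
      (\<lambda>_ ext. lam (\<lambda>Q.
        pi (pi A (\<lambda>x. Q \<cdot> (f \<cdot> x))) (\<lambda>g.
          sigma (pi B (\<lambda>y. Q \<cdot> y)) (\<lambda>h. pi A (\<lambda>x. Id (Q \<cdot> (f \<cdot> x)) (h \<cdot> (f \<cdot> x)) (g \<cdot> x))))
        \<times>\<^sub>t
        pi (pi B (\<lambda>y. Q \<cdot> y)) (\<lambda>g. pi (pi B (\<lambda>y. Q \<cdot> y)) (\<lambda>h.
          ext \<cdot> lam (\<lambda>y. Id (Q \<cdot> y) (g \<cdot> y) (h \<cdot> y))))))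
      m
    \<cdot> P"

definition Is_infty_extendable_along :: "level \<Rightarrow> level \<Rightarrow> level \<Rightarrow> stm \<Rightarrow> stm \<Rightarrow> stm \<Rightarrow> stm \<Rightarrow> stm" where
  "Is_infty_extendable_along a b c A B f P = pi nat_type (\<lambda>m. extendable a b c A B m f P)"

section \<open>The axiomatisations\<close>

definition bracket_cong_1 :: "level \<Rightarrow> stm" where
  "bracket_cong_1 a =
    sigma (pi0 (Type a) (\<lambda>A. pi0 A (\<lambda>x. pi0 A (\<lambda>y.
             Id A x y \<rightarrow>\<^sub>0 Id (Er A) (box x) (box y))))) (\<lambda>bcong.
    pi0 (Type a) (\<lambda>A. pi0 A (\<lambda>x.
      Id (Id (Er A) (box x) (box x)) (bcong \<cdot>\<^sub>0 A \<cdot>\<^sub>0 x \<cdot>\<^sub>0 x \<cdot>\<^sub>0 refl) refl)))"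

definition bracket_cong_2 :: "level \<Rightarrow> stm" where
  "bracket_cong_2 a =
    sigma (pi (Type a) (\<lambda>A. pi A (\<lambda>x. pi A (\<lambda>y.
             Id A x y \<rightarrow>\<^sub>0 Id (Er A) (box x) (box y))))) (\<lambda>bcong.
    pi (Type a) (\<lambda>A. pi A (\<lambda>x.
      Id (Id (Er A) (box x) (box x)) (bcong \<cdot> A \<cdot> x \<cdot> x \<cdot>\<^sub>0 refl) refl)))"

definition bracket_cong_3 :: "level \<Rightarrow> stm" where
  "bracket_cong_3 a =
    sigma (pi0 (Type a) (\<lambda>A. Stable_equality_E (Er A))) (\<lambda>f.
    pi0 (Type a) (\<lambda>A. pi (Er A) (\<lambda>x.
      Id (Id (Er A) x x) (f \<cdot>\<^sub>0 A \<cdot> x \<cdot> x \<cdot> box refl) refl)))"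

definition bracket_cong_4 :: "level \<Rightarrow> stm" where
  "bracket_cong_4 a =
    pi0 (Type a) (\<lambda>A. pi0 A (\<lambda>x. pi0 A (\<lambda>y.
      Is_equivalence (Id (Er A) (box x) (box y)) (Er (Id A x y))
        (lam (\<lambda>eq. box (cong (Er A) A (erased A) (box x) (box y) eq))))))"

definition bracket_cong_5 :: "level \<Rightarrow> stm" where
  "bracket_cong_5 a =
    pi0 (Type a) (\<lambda>A. pi (Er A) (\<lambda>x. pi (Er A) (\<lambda>y.
      Is_equivalence (Id (Er A) x y) (Er (Id A (erased A x) (erased A y)))
        (lam (\<lambda>eq. box (cong (Er A) A (erased A) x y eq))))))"

definition bracket_cong_6 :: "level \<Rightarrow> stm" where
  "bracket_cong_6 a = pi0 (Type a) (\<lambda>A. Separated_E (Er A))"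

definition bracket_cong_7 :: "level \<Rightarrow> stm" where
  "bracket_cong_7 a =
    pi0 (Type a) (\<lambda>A. Modal_E (Er A)) \<times>\<^sub>t
    pi (Type a) (\<lambda>A. Modal_E A \<rightarrow>\<^sub>t Separated_E A)"

definition bracket_cong_8 :: "level \<Rightarrow> stm" where
  "bracket_cong_8 a =
    sigma (pi0 (Type a) (\<lambda>A. pi0 A (\<lambda>x. pi0 A (\<lambda>y. pi (A \<rightarrow>\<^sub>0 Type a) (\<lambda>P.
             Id A x y \<rightarrow>\<^sub>0 P \<cdot>\<^sub>0 x \<rightarrow>\<^sub>t P \<cdot>\<^sub>0 y))))) (\<lambda>subst.
    pi0 (Type a) (\<lambda>A. pi0 A (\<lambda>x. pi (A \<rightarrow>\<^sub>0 Type a) (\<lambda>P. pi (P \<cdot>\<^sub>0 x) (\<lambda>p.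
      Id (P \<cdot>\<^sub>0 x) (subst \<cdot>\<^sub>0 A \<cdot>\<^sub>0 x \<cdot>\<^sub>0 x \<cdot> P \<cdot>\<^sub>0 refl \<cdot> p) p)))))"

definition bracket_cong_9 :: "level \<Rightarrow> stm" where
  "bracket_cong_9 a =
    sigma (pi0 (Type a) (\<lambda>A. pi0 A (\<lambda>x. pi0 A (\<lambda>y.
             pi (pi0 A (\<lambda>z. Id A x z \<rightarrow>\<^sub>0 Type a)) (\<lambda>P.
             P \<cdot>\<^sub>0 x \<cdot>\<^sub>0 refl \<rightarrow>\<^sub>t pi0 (Id A x y) (\<lambda>eq. P \<cdot>\<^sub>0 y \<cdot>\<^sub>0 eq)))))) (\<lambda>J_E.
    pi0 (Type a) (\<lambda>A. pi0 A (\<lambda>x.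
      pi (pi0 A (\<lambda>z. Id A x z \<rightarrow>\<^sub>0 Type a)) (\<lambda>P. pi (P \<cdot>\<^sub>0 x \<cdot>\<^sub>0 refl) (\<lambda>r.
        Id (P \<cdot>\<^sub>0 x \<cdot>\<^sub>0 refl) (J_E \<cdot>\<^sub>0 A \<cdot>\<^sub>0 x \<cdot>\<^sub>0 x \<cdot> P \<cdot> r \<cdot>\<^sub>0 refl) r)))))"

definition bracket_cong_10 :: "level \<Rightarrow> stm" where
  "bracket_cong_10 a =
    pi (Type a) (\<lambda>A. pi (Type a) (\<lambda>B.
      Is_infty_extendable_along a a a A (Er A) (lam (\<lambda>x. box x)) (lam (\<lambda>_. Er B))))"

definition bracket_cong_axiomatisations :: "level \<Rightarrow> stm set" where
  "bracket_cong_axiomatisations a =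
    {bracket_cong_1 a, bracket_cong_2 a, bracket_cong_3 a, bracket_cong_4 a, bracket_cong_5 a,
     bracket_cong_6 a, bracket_cong_7 a, bracket_cong_8 a, bracket_cong_9 a, bracket_cong_10 a}"

end

theory Submission
  imports Defs
begin

text \<open>
  By function extensionality an erased proof \<open>eq\<close> of \<open>x \<equiv> y\<close> can be avoided in present positions:
  with \<open>D = ([x] \<equiv> [y])\<close>, the constant functions \<open>D \<rightarrow> Erased A\<close> with values \<open>[x]\<close> and \<open>[y]\<close> are
  pointwise equal (the argument is the proof), hence equal, and applying the map
  \<open>f \<mapsto> [erased (f (cong [_] eq))]\<close>, in which \<open>eq\<close> only occurs under a box, to this equality gives
  \<open>[x] \<equiv> [y]\<close>. Composition with the inverse of the proof for \<open>refl\<close> makes the computation rule hold.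
  This is axiomatisation 1, from which the others follow without extensionality.

  If \<open>[_] : A \<rightarrow> Erased A\<close> has a retraction \<open>s\<close>, then conjugating \<open>cong s ([]-cong eq)\<close> gives a map
  \<open>Erased (x \<equiv> y) \<rightarrow> x \<equiv> y\<close>. In the half adjoint equivalences the right inverse law is \<open>[]-cong\<close>
  applied to an erased proof, and the left inverse law is chosen in such a way that the coherence law
  becomes an instance of \<open>cong ([_] \<circ> g) q \<equiv> []-cong (cong g q)\<close>, which is proved by J.

  That the resulting terms have the required types is decided by a bidirectional type checker, which
  is sound with respect to the typing rules.
\<close>

section \<open>Stability of typing under substitution\<close>

lemma up_ren_simps [simp]: "up_ren r 0 = 0" "up_ren r (Suc i) = Suc (r i)"
  by (simp_all add: up_ren_def)

lemma up_simps [simp]: "up \<sigma> 0 = Var 0" "up \<sigma> (Suc i) = lift (\<sigma> i)"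
  by (simp_all add: up_def)

lemma up_ren_comp: "up_ren r \<circ> up_ren s = up_ren (r \<circ> s)"
  by (rule ext, case_tac x) auto

lemma ren_ren: "ren r (ren s t) = ren (r \<circ> s) t"
  by (induction t arbitrary: r s) (simp_all add: up_ren_comp)

lemma up_comp_up_ren: "up \<sigma> \<circ> up_ren r = up (\<sigma> \<circ> r)"
  by (rule ext, case_tac x) auto

lemma sub_ren: "sub \<sigma> (ren r t) = sub (\<sigma> \<circ> r) t"
  by (induction t arbitrary: r \<sigma>) (simp_all add: up_comp_up_ren)

lemma ren_comp_up: "ren (up_ren r) \<circ> up \<sigma> = up (ren r \<circ> \<sigma>)"
  by (rule ext, case_tac x) (auto simp: o_def ren_ren)

lemma ren_sub: "ren r (sub \<sigma> t) = sub (ren r \<circ> \<sigma>) t"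
  by (induction t arbitrary: r \<sigma>) (simp_all add: ren_comp_up)

lemma sub_comp_up: "sub (up \<tau>) \<circ> up \<sigma> = up (sub \<tau> \<circ> \<sigma>)"
  by (rule ext, case_tac x) (auto simp: o_def sub_ren ren_sub)

lemma sub_sub: "sub \<tau> (sub \<sigma> t) = sub (sub \<tau> \<circ> \<sigma>) t"
  by (induction t arbitrary: \<tau> \<sigma>) (simp_all add: sub_comp_up)

lemma up_Var: "up Var = Var"
  by (rule ext, case_tac x) auto

lemma sub_Var [simp]: "sub Var t = t"
  by (induction t) (simp_all add: up_Var)

lemma up_Var_comp: "up (Var \<circ> r) = Var \<circ> up_ren r"
  by (rule ext, case_tac x) auto

text \<open>Renamings are variable-valued substitutions, so a single stability proof can serve for
  both.\<close>

lemma ren_as_sub: "ren r t = sub (Var \<circ> r) t"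
  by (induction t arbitrary: r) (simp_all add: up_Var_comp)

lemma sub_eqI: "(\<And>i. \<sigma> i = \<tau> i) \<Longrightarrow> sub \<sigma> t = sub \<tau> t"
  by (rule arg_cong[where f = "\<lambda>s. sub s t"]) auto

lemma sub_lift: "sub (up \<sigma>) (lift t) = lift (sub \<sigma> t)"
  by (auto simp: sub_ren ren_sub intro: sub_eqI)

lemma sub_lift2: "sub (case_nat u Var) (lift t) = t"
  by (simp add: sub_ren o_def)

lemma sub_sub1: "sub \<sigma> (sub1 t u) = sub1 (sub (up \<sigma>) t) (sub \<sigma> u)"
  by (auto simp: sub_sub sub_lift2 intro!: sub_eqI split: nat.split)

lemma sub_sub2: "sub \<sigma> (sub2 t u v) = sub2 (sub (up (up \<sigma>)) t) (sub \<sigma> u) (sub \<sigma> v)"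
  by (auto simp: sub_sub sub_ren o_def intro!: sub_eqI split: nat.split)

lemma sub_succ_motive:
  "sub (up (up \<sigma>)) (sub (case_nat (Succ (Var 1)) (\<lambda>i. Var (i + 2))) C) =
    sub (case_nat (Succ (Var 1)) (\<lambda>i. Var (i + 2))) (sub (up \<sigma>) C)"
  by (auto simp: sub_sub sub_ren ren_ren o_def ren_as_sub intro!: sub_eqI split: nat.split)

lemma sub_box_motive:
  "sub (up \<sigma>) (sub (case_nat (Box (Var 0)) (\<lambda>i. Var (i + 1))) C) =
    sub (case_nat (Box (Var 0)) (\<lambda>i. Var (i + 1))) (sub (up \<sigma>) C)"
  by (auto simp: sub_sub sub_ren ren_ren o_def ren_as_sub intro!: sub_eqI split: nat.split)

text \<open>The last two entries repeat the branch types in the normal form of the simplifier, with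
  \<open>Suc 0\<close> for \<open>1\<close> and \<open>Suc i\<close> for \<open>i + 1\<close>, which
  is how they appear in goals that \<open>auto\<close> has touched.\<close>

lemmas sub_motives = sub_lift sub_sub1 sub_sub2 sub_succ_motive sub_box_motive
  sub_succ_motive[simplified] sub_box_motive[simplified]

lemma beta_conv_sub: "t \<approx>\<^sub>\<beta> u \<Longrightarrow> sub \<sigma> t \<approx>\<^sub>\<beta> sub \<sigma> u"
proof (induction arbitrary: \<sigma> rule: beta_conv.induct)
  case (bc_trans t u v)
  then show ?case by (blast intro: beta_conv.bc_trans)
qed (auto simp: sub_sub1 sub_sub2 intro: beta_conv.intros)

section \<open>Well-typed renamings and substitutions\<close>

definition ctx_type :: "tm list \<Rightarrow> nat \<Rightarrow> tm" where
  "ctx_type \<Gamma> i = ren (\<lambda>j. j + Suc i) (\<Gamma> ! i)"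

lemma ctx_type_simps [simp]:
  "ctx_type (A # \<Gamma>) 0 = lift A" "ctx_type (A # \<Gamma>) (Suc i) = lift (ctx_type \<Gamma> i)"
  by (auto simp: ctx_type_def ren_ren o_def)

lemma typing_var: "i < length \<Gamma> \<Longrightarrow> \<Gamma> \<turnstile> Var i \<^bold>: ctx_type \<Gamma> i"
  using t_var by (simp add: ctx_type_def)

definition ren_typing :: "tm list \<Rightarrow> (nat \<Rightarrow> nat) \<Rightarrow> tm list \<Rightarrow> bool" where
  "ren_typing \<Delta> r \<Gamma> \<longleftrightarrow>
    (\<forall>i<length \<Gamma>. r i < length \<Delta> \<and> ctx_type \<Delta> (r i) = ren r (ctx_type \<Gamma> i))"

definition sub_typing :: "tm list \<Rightarrow> (nat \<Rightarrow> tm) \<Rightarrow> tm list \<Rightarrow> bool" where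
  "sub_typing \<Delta> \<sigma> \<Gamma> \<longleftrightarrow> (\<forall>i<length \<Gamma>. \<Delta> \<turnstile> \<sigma> i \<^bold>: sub \<sigma> (ctx_type \<Gamma> i))"

lemma ren_typing_up: "ren_typing \<Delta> r \<Gamma> \<Longrightarrow> ren_typing (ren r A # \<Delta>) (up_ren r) (A # \<Gamma>)"
  unfolding ren_typing_def by (auto simp: less_Suc_eq_0_disj ren_ren o_def)

text \<open>The class \<open>Q\<close> is instantiated twice: with renamings, and then with well-typed substitutions, which
  are closed under \<open>up\<close> only because typing is stable under renaming.\<close>

lemma typing_stable:
  assumes Q_var: "\<And>\<Delta> \<sigma> \<Gamma> i. Q \<Delta> \<sigma> \<Gamma> \<Longrightarrow> i < length \<Gamma> \<Longrightarrow> \<Delta> \<turnstile> \<sigma> i \<^bold>: sub \<sigma> (ctx_type \<Gamma> i)"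
    and Q_up: "\<And>\<Delta> \<sigma> \<Gamma> A. Q \<Delta> \<sigma> \<Gamma> \<Longrightarrow> Q (sub \<sigma> A # \<Delta>) (up \<sigma>) (A # \<Gamma>)"
  shows "\<Gamma> \<turnstile> t \<^bold>: A \<Longrightarrow> Q \<Delta> \<sigma> \<Gamma> \<Longrightarrow> \<Delta> \<turnstile> sub \<sigma> t \<^bold>: sub \<sigma> A"
    and "\<Gamma> \<turnstile> t \<doteq> u \<^bold>: A \<Longrightarrow> Q \<Delta> \<sigma> \<Gamma> \<Longrightarrow> \<Delta> \<turnstile> sub \<sigma> t \<doteq> sub \<sigma> u \<^bold>: sub \<sigma> A"
proof -
  \<comment> \<open>For a fixed head type the substitution computes to \<open>Nat\<close> or to
    \<open>Erased\<close> of a substituted type; the general form of \<open>Q_up\<close> would no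
    longer match.\<close>
  note Q_nat = Q_up[where A = Nat, simplified]
    and Q_erased = Q_up[where A = "Erased A" for A, simplified]
  \<comment> \<open>The two-variable context of the motive of J: substitution commutes with the
    weakenings inside the identity type.\<close>
  have Q_eq: "Q (Eq (lift (sub \<sigma> A)) (lift (sub \<sigma> t)) (Var 0) # sub \<sigma> A # \<Delta>) (up (up \<sigma>))
      (Eq (lift A) (lift t) (Var 0) # A # \<Gamma>)" if "Q \<Delta> \<sigma> \<Gamma>" for \<Delta> \<sigma> \<Gamma> A t
    using Q_up[OF Q_up[OF that], of "Eq (lift A) (lift t) (Var 0)"] by (simp add: sub_lift)
  show "\<Gamma> \<turnstile> t \<^bold>: A \<Longrightarrow> Q \<Delta> \<sigma> \<Gamma> \<Longrightarrow> \<Delta> \<turnstile> sub \<sigma> t \<^bold>: sub \<sigma> A"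
    and "\<Gamma> \<turnstile> t \<doteq> u \<^bold>: A \<Longrightarrow> Q \<Delta> \<sigma> \<Gamma> \<Longrightarrow> \<Delta> \<turnstile> sub \<sigma> t \<doteq> sub \<sigma> u \<^bold>: sub \<sigma> A"
  proof (induction arbitrary: \<Delta> \<sigma> and \<Delta> \<sigma> rule: typing_tm_eq.inducts)
    case (t_var i \<Gamma>)
    then show ?case using Q_var[of \<Delta> \<sigma> \<Gamma> i] by (simp add: ctx_type_def)
  next
    case t_univ
    then show ?case
      by (auto simp: sub_motives intro!: typing_tm_eq.t_univ Q_up Q_nat Q_erased Q_eq)
  next
    case t_pi
    then show ?case
      by (auto simp: sub_motives intro!: typing_tm_eq.t_pi Q_up Q_nat Q_erased Q_eq
        intro: t_pi.IH[simplified, unfolded sub_motives] t_pi.prems)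
  next
    case t_lam
    then show ?case
      by (auto simp: sub_motives intro!: typing_tm_eq.t_lam Q_up Q_nat Q_erased Q_eq
        intro: t_lam.IH[simplified, unfolded sub_motives] t_lam.prems)
  next
    case t_app
    then show ?case
      by (auto simp: sub_motives intro!: typing_tm_eq.t_app Q_up Q_nat Q_erased Q_eq
        intro: t_app.IH[simplified, unfolded sub_motives] t_app.prems)
  next
    case t_sig
    then show ?case
      by (auto simp: sub_motives intro!: typing_tm_eq.t_sig Q_up Q_nat Q_erased Q_eq
        intro: t_sig.IH[simplified, unfolded sub_motives] t_sig.prems)
  next
    case t_pair
    then show ?case
      by (auto simp: sub_motives intro!: typing_tm_eq.t_pair Q_up Q_nat Q_erased Q_eq
        intro: t_pair.IH[simplified, unfolded sub_motives] t_pair.prems)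
  next
    case t_fst
    then show ?case
      by (auto simp: sub_motives intro!: typing_tm_eq.t_fst Q_up Q_nat Q_erased Q_eq
        intro: t_fst.IH[simplified, unfolded sub_motives] t_fst.prems)
  next
    case t_snd
    then show ?case
      by (auto simp: sub_motives intro!: typing_tm_eq.t_snd Q_up Q_nat Q_erased Q_eq
        intro: t_snd.IH[simplified, unfolded sub_motives] t_snd.prems)
  next
    case t_unit
    then show ?case
      by (auto simp: sub_motives intro!: typing_tm_eq.t_unit Q_up Q_nat Q_erased Q_eq)
  next
    case t_star
    then show ?case
      by (auto simp: sub_motives intro!: typing_tm_eq.t_star Q_up Q_nat Q_erased Q_eq)
  next
    case t_nat
    then show ?case
      by (auto simp: sub_motives intro!: typing_tm_eq.t_nat Q_up Q_nat Q_erased Q_eq)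
  next
    case t_zero
    then show ?case
      by (auto simp: sub_motives intro!: typing_tm_eq.t_zero Q_up Q_nat Q_erased Q_eq)
  next
    case t_succ
    then show ?case
      by (auto simp: sub_motives intro!: typing_tm_eq.t_succ Q_up Q_nat Q_erased Q_eq
        intro: t_succ.IH[simplified, unfolded sub_motives] t_succ.prems)
  next
    \<comment> \<open>The hypothesis for the successor branch is instantiated at
      \<open>up (up \<tau>)\<close> first, so that the substitution can be pushed into the instance
      of the motive before simplification changes its shape.\<close>
    case t_natrec
    then show ?case
      by (auto simp: sub_motives intro!: typing_tm_eq.t_natrec Q_up Q_nat Q_erased Q_eq
        intro: t_natrec.IH(3)[where \<sigma> = "up (up \<tau>)" for \<tau>, unfolded sub_motives, simplified]
          t_natrec.IH[simplified, unfolded sub_motives] t_natrec.prems)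
  next
    case t_eq
    then show ?case
      by (auto simp: sub_motives intro!: typing_tm_eq.t_eq Q_up Q_nat Q_erased Q_eq
        intro: t_eq.IH[simplified, unfolded sub_motives] t_eq.prems)
  next
    case t_rfl
    then show ?case
      by (auto simp: sub_motives intro!: typing_tm_eq.t_rfl Q_up Q_nat Q_erased Q_eq
        intro: t_rfl.IH[simplified, unfolded sub_motives] t_rfl.prems)
  next
    case t_J
    then show ?case
      by (auto simp: sub_motives intro!: typing_tm_eq.t_J Q_up Q_nat Q_erased Q_eq
        intro: t_J.IH[simplified, unfolded sub_motives] t_J.prems)
  next
    case t_erased
    then show ?case
      by (auto simp: sub_motives intro!: typing_tm_eq.t_erased Q_up Q_nat Q_erased Q_eq
        intro: t_erased.IH[simplified, unfolded sub_motives] t_erased.prems)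
  next
    case t_box
    then show ?case
      by (auto simp: sub_motives intro!: typing_tm_eq.t_box Q_up Q_nat Q_erased Q_eq
        intro: t_box.IH[simplified, unfolded sub_motives] t_box.prems)
  next
    case t_unbox
    then show ?case
      by (auto simp: sub_motives intro!: typing_tm_eq.t_unbox Q_up Q_nat Q_erased Q_eq
        intro: t_unbox.IH(3)[where \<sigma> = "up \<tau>" for \<tau>, unfolded sub_motives, simplified]
          t_unbox.IH[simplified, unfolded sub_motives] t_unbox.prems)
  next
    case t_conv_beta
    then show ?case by (metis (no_types) typing_tm_eq.t_conv_beta beta_conv_sub sub.simps(2))
  next
    case t_conv
    then show ?case by (metis (no_types) typing_tm_eq.t_conv beta_conv_sub sub.simps(2))
  next
    case eq_beta
    then show ?case by (metis (no_types) typing_tm_eq.eq_beta beta_conv_sub sub.simps(2))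
  next
    case eq_conv
    then show ?case by (metis (no_types) typing_tm_eq.eq_conv beta_conv_sub sub.simps(2))
  next
    case eq_sym
    then show ?case by (metis (no_types) typing_tm_eq.eq_sym beta_conv_sub sub.simps(2))
  next
    case eq_trans
    then show ?case by (metis (no_types) typing_tm_eq.eq_trans beta_conv_sub sub.simps(2))
  next
    \<comment> \<open>The fourth hypothesis lives under the binder; with \<open>up \<tau>\<close>
      the substitution passes through the weakened functions.\<close>
    case eq_fun
    then show ?case
      by (auto simp: sub_motives intro!: typing_tm_eq.eq_fun Q_up Q_nat Q_erased Q_eq
        intro: eq_fun.IH(4)[where \<sigma> = "up \<tau>" for \<tau>, simplified, unfolded sub_motives]
          eq_fun.IH[simplified, unfolded sub_motives] eq_fun.prems)
  next
    case eq_pair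
    then show ?case
      by (auto simp: sub_motives intro!: typing_tm_eq.eq_pair Q_up Q_nat Q_erased Q_eq
        intro: eq_pair.IH[simplified, unfolded sub_motives] eq_pair.prems)
  next
    case eq_unit
    then show ?case
      by (auto simp: sub_motives intro!: typing_tm_eq.eq_unit Q_up Q_nat Q_erased Q_eq
        intro: eq_unit.IH[simplified, unfolded sub_motives] eq_unit.prems)
  next
    case eq_subst
    then show ?case
      by (auto simp: sub_motives intro!: typing_tm_eq.eq_subst Q_up Q_nat Q_erased Q_eq
        intro: eq_subst.IH[simplified, unfolded sub_motives] eq_subst.prems)
  next
    case eq_pi
    then show ?case
      by (auto simp: sub_motives intro!: typing_tm_eq.eq_pi Q_up Q_nat Q_erased Q_eq
        intro: eq_pi.IH[simplified, unfolded sub_motives] eq_pi.prems)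
  next
    case eq_sig
    then show ?case
      by (auto simp: sub_motives intro!: typing_tm_eq.eq_sig Q_up Q_nat Q_erased Q_eq
        intro: eq_sig.IH[simplified, unfolded sub_motives] eq_sig.prems)
  next
    case eq_natrec
    then show ?case
      by (auto simp: sub_motives intro!: typing_tm_eq.eq_natrec Q_up Q_nat Q_erased Q_eq
        intro: eq_natrec.IH(4)[where \<sigma> = "up (up \<tau>)" for \<tau>, unfolded sub_motives, simplified]
          eq_natrec.IH[simplified, unfolded sub_motives] eq_natrec.prems)
  next
    case eq_J
    then show ?case
      by (auto simp: sub_motives intro!: typing_tm_eq.eq_J Q_up Q_nat Q_erased Q_eq
        intro: eq_J.IH[simplified, unfolded sub_motives] eq_J.prems)
  next
    case eq_unbox
    then show ?case
      by (auto simp: sub_motives intro!: typing_tm_eq.eq_unbox Q_up Q_nat Q_erased Q_eq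
        intro: eq_unbox.IH(3)[where \<sigma> = "up \<tau>" for \<tau>, unfolded sub_motives, simplified]
          eq_unbox.IH[simplified, unfolded sub_motives] eq_unbox.prems)
  qed
qed

lemma typing_ren:
  assumes "\<Gamma> \<turnstile> t \<^bold>: A" "ren_typing \<Delta> r \<Gamma>"
  shows "\<Delta> \<turnstile> ren r t \<^bold>: ren r A"
proof -
  let ?Q = "\<lambda>\<Delta> \<sigma> \<Gamma>. \<exists>r. \<sigma> = Var \<circ> r \<and> ren_typing \<Delta> r \<Gamma>"
  have "\<Delta> \<turnstile> sub (Var \<circ> r) t \<^bold>: sub (Var \<circ> r) A"
  proof (rule typing_stable(1)[where Q = ?Q])
    fix \<Delta> \<sigma> \<Gamma> i
    assume "?Q \<Delta> \<sigma> \<Gamma>" "i < length \<Gamma>"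
    then show "\<Delta> \<turnstile> \<sigma> i \<^bold>: sub \<sigma> (ctx_type \<Gamma> i)"
      by (metis comp_apply ren_as_sub ren_typing_def typing_var)
  next
    fix \<Delta> \<sigma> \<Gamma> A
    assume "?Q \<Delta> \<sigma> \<Gamma>"
    then show "?Q (sub \<sigma> A # \<Delta>) (up \<sigma>) (A # \<Gamma>)"
      by (metis ren_as_sub ren_typing_up up_Var_comp)
  qed (use assms in auto)
  then show ?thesis by (simp add: ren_as_sub)
qed

lemma typing_lift: "\<Gamma> \<turnstile> t \<^bold>: A \<Longrightarrow> B # \<Gamma> \<turnstile> lift t \<^bold>: lift A"
  by (rule typing_ren) (auto simp: ren_typing_def)

lemma sub_typing_up:
  assumes "sub_typing \<Delta> \<sigma> \<Gamma>"
  shows "sub_typing (sub \<sigma> A # \<Delta>) (up \<sigma>) (A # \<Gamma>)"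
  unfolding sub_typing_def
proof (intro allI impI)
  fix i assume i: "i < length (A # \<Gamma>)"
  show "sub \<sigma> A # \<Delta> \<turnstile> up \<sigma> i \<^bold>: sub (up \<sigma>) (ctx_type (A # \<Gamma>) i)"
  proof (cases i)
    case 0
    then show ?thesis using typing_var[of 0 "sub \<sigma> A # \<Delta>"] by (simp add: sub_lift)
  next
    case (Suc j)
    then show ?thesis using assms i by (auto simp: sub_typing_def sub_lift intro: typing_lift)
  qed
qed

lemma typing_sub: "\<Gamma> \<turnstile> t \<^bold>: A \<Longrightarrow> sub_typing \<Delta> \<sigma> \<Gamma> \<Longrightarrow> \<Delta> \<turnstile> sub \<sigma> t \<^bold>: sub \<sigma> A"
  by (rule typing_stable(1)[where Q = sub_typing]) (auto simp: sub_typing_up, simp add: sub_typing_def)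

lemma sub_typing_case_nat:
  assumes "\<Delta> \<turnstile> u \<^bold>: sub \<tau> A" "sub_typing \<Delta> \<tau> \<Gamma>"
  shows "sub_typing \<Delta> (case_nat u \<tau>) (A # \<Gamma>)"
  unfolding sub_typing_def
proof (intro allI impI)
  fix i assume "i < length (A # \<Gamma>)"
  then show "\<Delta> \<turnstile> case_nat u \<tau> i \<^bold>: sub (case_nat u \<tau>) (ctx_type (A # \<Gamma>) i)"
    using assms by (cases i) (auto simp: sub_typing_def sub_ren o_def)
qed

lemma sub_typing_Var: "sub_typing \<Gamma> Var \<Gamma>"
  by (simp add: sub_typing_def typing_var)

text \<open>The tail of the substitution in the type of an \<open>Unbox\<close> branch; the variant
  that shifts by two serves the successor branch of \<open>Natrec\<close>.\<close>

lemma sub_typing_shift: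
  "sub_typing (A # \<Gamma>) (\<lambda>i. Var (Suc i)) \<Gamma>"
  using typing_var[of "Suc i" "A # \<Gamma>" for i]
  by (auto simp: sub_typing_def ren_as_sub o_def)

lemma sub_typing_shift2:
  "sub_typing (B # A # \<Gamma>) (\<lambda>i. Var (Suc (Suc i))) \<Gamma>"
  using typing_var[of "Suc (Suc i)" "B # A # \<Gamma>" for i]
  by (auto simp: sub_typing_def ren_as_sub sub_sub o_def)

lemma typing_sub1: "A # \<Gamma> \<turnstile> t \<^bold>: B \<Longrightarrow> \<Gamma> \<turnstile> u \<^bold>: A \<Longrightarrow> \<Gamma> \<turnstile> sub1 t u \<^bold>: sub1 B u"
  by (erule typing_sub) (simp add: sub_typing_case_nat sub_typing_Var)

section \<open>Well-formed contexts and inversion for type formers\<close>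

inductive wf_ctx :: "tm list \<Rightarrow> bool" where
  wf_Nil: "wf_ctx []"
| wf_Cons: "wf_ctx \<Gamma> \<Longrightarrow> \<Gamma> \<turnstile> A \<^bold>: Univ l \<Longrightarrow> wf_ctx (A # \<Gamma>)"

lemma wf_ctx_type: "wf_ctx \<Gamma> \<Longrightarrow> i < length \<Gamma> \<Longrightarrow> \<exists>l. \<Gamma> \<turnstile> ctx_type \<Gamma> i \<^bold>: Univ l"
proof (induction arbitrary: i rule: wf_ctx.induct)
  case (wf_Cons \<Gamma> A l)
  show ?case
  proof (cases i)
    case 0
    then show ?thesis using typing_lift[OF wf_Cons.hyps(2)] by auto
  next
    case (Suc j)
    with wf_Cons obtain l' where "\<Gamma> \<turnstile> ctx_type \<Gamma> j \<^bold>: Univ l'" by force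
    from typing_lift[OF this] Suc show ?thesis by auto
  qed
qed simp

text \<open>Each formation rule has the components among its premises, and the conversion rules
  change \<open>C\<close> but keep \<open>T\<close>. The case distinction packs four inversions into
  one induction.\<close>

lemma typing_formerD:
  "\<Gamma> \<turnstile> T \<^bold>: C \<Longrightarrow> (case T of
      Pi q A B \<Rightarrow> (\<exists>k. \<Gamma> \<turnstile> A \<^bold>: Univ k) \<and> (\<exists>l. A # \<Gamma> \<turnstile> B \<^bold>: Univ l)
    | Sig A B \<Rightarrow> (\<exists>k. \<Gamma> \<turnstile> A \<^bold>: Univ k) \<and> (\<exists>l. A # \<Gamma> \<turnstile> B \<^bold>: Univ l)
    | Eq A t u \<Rightarrow> (\<exists>k. \<Gamma> \<turnstile> A \<^bold>: Univ k) \<and> \<Gamma> \<turnstile> t \<^bold>: A \<and> \<Gamma> \<turnstile> u \<^bold>: A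
    | Erased A \<Rightarrow> (\<exists>k. \<Gamma> \<turnstile> A \<^bold>: Univ k)
    | _ \<Rightarrow> True)"
  by (induction rule: typing_tm_eq.inducts(1)[where ?P2.0 = "\<lambda>_ _ _ _. True"]) auto

lemmas typing_PiD = typing_formerD[where T = "Pi q A B" for q A B, simplified]
lemmas typing_SigD = typing_formerD[where T = "Sig A B" for A B, simplified]
lemmas typing_EqD = typing_formerD[where T = "Eq A t u" for A t u, simplified]
lemmas typing_ErasedD = typing_formerD[where T = "Erased A" for A, simplified]

section \<open>A bidirectional type checker\<close>

text \<open>\<open>shift\<close> and \<open>inst\<close> are the instances of \<open>ren\<close> and \<open>sub\<close> that the checker needs, in a form that
  the simplifier evaluates without building up composed substitutions.\<close>

primrec shift :: "nat \<Rightarrow> nat \<Rightarrow> tm \<Rightarrow> tm" where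
  "shift d c (Var i) = Var (if i < c then i else i + d)"
| "shift d c (Univ l) = Univ l"
| "shift d c (Pi q A B) = Pi q (shift d c A) (shift d (Suc c) B)"
| "shift d c (Lam q t) = Lam q (shift d (Suc c) t)"
| "shift d c (App q t u) = App q (shift d c t) (shift d c u)"
| "shift d c (Sig A B) = Sig (shift d c A) (shift d (Suc c) B)"
| "shift d c (MkSig t u) = MkSig (shift d c t) (shift d c u)"
| "shift d c (Fst t) = Fst (shift d c t)"
| "shift d c (Snd t) = Snd (shift d c t)"
| "shift d c (Unit l) = Unit l"
| "shift d c Star = Star"
| "shift d c Nat = Nat"
| "shift d c Zero = Zero"
| "shift d c (Succ t) = Succ (shift d c t)"
| "shift d c (Natrec C z s n) =
    Natrec (shift d (Suc c) C) (shift d c z) (shift d (Suc (Suc c)) s) (shift d c n)"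
| "shift d c (Eq A t u) = Eq (shift d c A) (shift d c t) (shift d c u)"
| "shift d c Rfl = Rfl"
| "shift d c (J A t C u v e) = J (shift d c A) (shift d c t) (shift d (Suc (Suc c)) C)
    (shift d c u) (shift d c v) (shift d c e)"
| "shift d c (Erased A) = Erased (shift d c A)"
| "shift d c (Box t) = Box (shift d c t)"
| "shift d c (Unbox C b z) = Unbox (shift d (Suc c) C) (shift d (Suc c) b) (shift d c z)"

lemma up_ren_shift:
  "up_ren (\<lambda>i. if i < c then i else i + d) = (\<lambda>i. if i < Suc c then i else i + d)"
  by (rule ext, case_tac i) auto

lemma shift_ren: "shift d c t = ren (\<lambda>i. if i < c then i else i + d) t"
  by (induction t arbitrary: c) (simp_all add: up_ren_shift)

text \<open>Below \<open>c\<close> binders: smaller indices are bound, the next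
  \<open>length us\<close> indices are replaced by the entries of \<open>us\<close> (index 0 first),
  and the remaining ones drop by \<open>length us\<close> and rise by \<open>d\<close>, the number
  of variables that a branch adds.\<close>

definition insts :: "tm list \<Rightarrow> nat \<Rightarrow> nat \<Rightarrow> nat \<Rightarrow> tm" where
  "insts us d c i = (if i < c then Var i
    else if i - c < length us then shift c 0 (us ! (i - c)) else Var (i - length us + d))"

primrec inst :: "tm list \<Rightarrow> nat \<Rightarrow> nat \<Rightarrow> tm \<Rightarrow> tm" where
  "inst us d c (Var i) = insts us d c i"
| "inst us d c (Univ l) = Univ l"
| "inst us d c (Pi q A B) = Pi q (inst us d c A) (inst us d (Suc c) B)"
| "inst us d c (Lam q t) = Lam q (inst us d (Suc c) t)"
| "inst us d c (App q t u) = App q (inst us d c t) (inst us d c u)"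
| "inst us d c (Sig A B) = Sig (inst us d c A) (inst us d (Suc c) B)"
| "inst us d c (MkSig t u) = MkSig (inst us d c t) (inst us d c u)"
| "inst us d c (Fst t) = Fst (inst us d c t)"
| "inst us d c (Snd t) = Snd (inst us d c t)"
| "inst us d c (Unit l) = Unit l"
| "inst us d c Star = Star"
| "inst us d c Nat = Nat"
| "inst us d c Zero = Zero"
| "inst us d c (Succ t) = Succ (inst us d c t)"
| "inst us d c (Natrec C z s n) =
    Natrec (inst us d (Suc c) C) (inst us d c z) (inst us d (Suc (Suc c)) s) (inst us d c n)"
| "inst us d c (Eq A t u) = Eq (inst us d c A) (inst us d c t) (inst us d c u)"
| "inst us d c Rfl = Rfl"
| "inst us d c (J A t C u v e) = J (inst us d c A) (inst us d c t) (inst us d (Suc (Suc c)) C)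
    (inst us d c u) (inst us d c v) (inst us d c e)"
| "inst us d c (Erased A) = Erased (inst us d c A)"
| "inst us d c (Box t) = Box (inst us d c t)"
| "inst us d c (Unbox C b z) = Unbox (inst us d (Suc c) C) (inst us d (Suc c) b) (inst us d c z)"

lemma up_insts: "up (insts us d c) = insts us d (Suc c)"
proof
  fix i
  show "up (insts us d c) i = insts us d (Suc c) i"
    by (cases i) (auto simp: insts_def shift_ren ren_ren o_def)
qed

lemma inst_sub: "inst us d c t = sub (insts us d c) t"
  by (induction t arbitrary: c) (simp_all add: up_insts)

lemma inst_simps:
  "inst [u] 0 0 t = sub1 t u"
  "inst [v, u] 0 0 t = sub2 t u v"
  "inst [Succ (Var 1)] 2 0 t = sub (case_nat (Succ (Var 1)) (\<lambda>i. Var (i + 2))) t"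
  "inst [Box (Var 0)] 1 0 t = sub (case_nat (Box (Var 0)) (\<lambda>i. Var (i + 1))) t"
  by (auto simp: inst_sub insts_def shift_ren ren_as_sub o_def nth_Cons' intro!: sub_eqI split: nat.split)

section \<open>Normalisation as a test for conversion\<close>

primrec lnorm :: "level \<Rightarrow> level" where
  "lnorm (LVar i) = LVar i"
| "lnorm LZero = LZero"
| "lnorm (LSuc l) = LSuc (lnorm l)"
| "lnorm (LMax k l) = (if lnorm k = lnorm l then lnorm k else LMax (lnorm k) (lnorm l))"

lemma level_val_lnorm: "level_val v (lnorm l) = level_val v l"
  by (induction l; simp; metis max.idem)

text \<open>Soundness is what the checker relies on. Idempotence of the maximum identifies, for
  instance, the level \<open>LMax a (LMax a a)\<close> in \<open>extendable a a a\<close> with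
  \<open>a\<close>.\<close>

lemma level_eq_lnorm: "level_eq l (lnorm l)"
  by (simp add: level_eq_def level_val_lnorm)

text \<open>Raw terms may diverge, so \<open>nf\<close> is partial: \<open>None\<close> stands for
  divergence and for a redex whose annotations disagree. Results count only as evidence for
  conversion.\<close>

partial_function (option) nf :: "tm \<Rightarrow> tm option" where
  "nf t = (case t of
      Var i \<Rightarrow> Some (Var i)
    | Univ l \<Rightarrow> Some (Univ (lnorm l))
    | Pi q A B \<Rightarrow> Option.bind (nf A) (\<lambda>A. Option.bind (nf B) (\<lambda>B. Some (Pi q A B)))
    | Lam q t \<Rightarrow> Option.bind (nf t) (\<lambda>t. Some (Lam q t))
    | App q t u \<Rightarrow> Option.bind (nf t) (\<lambda>t'. case t' of
          Lam q' b \<Rightarrow> if q' = q then nf (inst [u] 0 0 b) else None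
        | _ \<Rightarrow> Option.bind (nf u) (\<lambda>u. Some (App q t' u)))
    | Sig A B \<Rightarrow> Option.bind (nf A) (\<lambda>A. Option.bind (nf B) (\<lambda>B. Some (Sig A B)))
    | MkSig t u \<Rightarrow> Option.bind (nf t) (\<lambda>t. Option.bind (nf u) (\<lambda>u. Some (MkSig t u)))
    | Fst t \<Rightarrow> Option.bind (nf t) (\<lambda>t'. case t' of MkSig u v \<Rightarrow> Some u | _ \<Rightarrow> Some (Fst t'))
    | Snd t \<Rightarrow> Option.bind (nf t) (\<lambda>t'. case t' of MkSig u v \<Rightarrow> Some v | _ \<Rightarrow> Some (Snd t'))
    | Unit l \<Rightarrow> Some (Unit (lnorm l))
    | Star \<Rightarrow> Some Star
    | Nat \<Rightarrow> Some Nat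
    | Zero \<Rightarrow> Some Zero
    | Succ t \<Rightarrow> Option.bind (nf t) (\<lambda>t. Some (Succ t))
    | Natrec C z s n \<Rightarrow> Option.bind (nf n) (\<lambda>n'. case n' of
          Zero \<Rightarrow> nf z
        | Succ m \<Rightarrow> nf (inst [Natrec C z s m, m] 0 0 s)
        | _ \<Rightarrow> Option.bind (nf C) (\<lambda>C. Option.bind (nf z) (\<lambda>z. Option.bind (nf s) (\<lambda>s.
            Some (Natrec C z s n')))))
    | Eq A t u \<Rightarrow> Option.bind (nf A) (\<lambda>A. Option.bind (nf t) (\<lambda>t. Option.bind (nf u) (\<lambda>u. Some (Eq A t u))))
    | Rfl \<Rightarrow> Some Rfl
    | J A t C u v e \<Rightarrow> Option.bind (nf e) (\<lambda>e'. case e' of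
          Rfl \<Rightarrow> nf u
        | _ \<Rightarrow> Option.bind (nf A) (\<lambda>A. Option.bind (nf t) (\<lambda>t. Option.bind (nf C) (\<lambda>C.
            Option.bind (nf u) (\<lambda>u. Option.bind (nf v) (\<lambda>v. Some (J A t C u v e')))))))
    | Erased A \<Rightarrow> Option.bind (nf A) (\<lambda>A. Some (Erased A))
    | Box t \<Rightarrow> Option.bind (nf t) (\<lambda>t. Some (Box t))
    | Unbox C b z \<Rightarrow> Option.bind (nf z) (\<lambda>z'. case z' of
          Box t \<Rightarrow> nf (inst [t] 0 0 b)
        | _ \<Rightarrow> Option.bind (nf C) (\<lambda>C. Option.bind (nf b) (\<lambda>b. Some (Unbox C b z')))))"

lemma nf_beta_conv: "nf t = Some t' \<Longrightarrow> t \<approx>\<^sub>\<beta> t'"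
proof (induction t t' rule: nf.raw_induct[rotated, consumes 1, case_names step])
  \<comment> \<open>Fixpoint induction: \<open>f\<close> approximates \<open>nf\<close>, and its
    results on the recursive calls are assumed to be convertible to the input.\<close>
  case (step f t t')
  note IH = step(1) and eq = step(2)
  \<comment> \<open>The pattern of a contraction: bring the head into redex form, contract, and let
    \<open>f\<close> continue with the contractum.\<close>
  have via: "t \<approx>\<^sub>\<beta> t'" if "t \<approx>\<^sub>\<beta> u" "u \<approx>\<^sub>\<beta> v" "f v = Some t'" for u v
    using that IH bc_trans by blast
  show ?case
  proof (cases t)
    case (App q s u)
    with eq obtain s' where s': "f s = Some s'" by (cases "f s") auto
    have red: "App q s u \<approx>\<^sub>\<beta> App q s' u" by (intro bc_app IH[OF s'] bc_refl)
    show ?thesis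
    proof (cases "\<exists>b. s' = Lam q b")
      case True
      then obtain b where b: "s' = Lam q b" by blast
      with App eq s' have "f (sub1 b u) = Some t'" by (simp add: inst_simps)
      with red b App show ?thesis by (metis IH bc_trans bc_app_lam)
    next
      case False
      with App eq s' show ?thesis
        by (cases s') (auto simp: bind_eq_Some_conv intro: bc_app IH)
    qed
  next
    case (Fst s)
    with eq obtain s' where s': "f s = Some s'" by (cases "f s") auto
    have red: "Fst s \<approx>\<^sub>\<beta> Fst s'" by (intro bc_fst IH[OF s'])
    show ?thesis
    proof (cases "\<exists>u v. s' = MkSig u v")
      case True
      with Fst eq s' obtain v where "s' = MkSig t' v" by auto
      with bc_trans[OF red] bc_fst_pair Fst show ?thesis by metis
    next
      case False
      with Fst eq s' red show ?thesis by (cases s') auto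
    qed
  next
    case (Snd s)
    with eq obtain s' where s': "f s = Some s'" by (cases "f s") auto
    have red: "Snd s \<approx>\<^sub>\<beta> Snd s'" by (intro bc_snd IH[OF s'])
    show ?thesis
    proof (cases "\<exists>u v. s' = MkSig u v")
      case True
      with Snd eq s' obtain v where "s' = MkSig v t'" by auto
      with bc_trans[OF red] bc_snd_pair Snd show ?thesis by metis
    next
      case False
      with Snd eq s' red show ?thesis by (cases s') auto
    qed
  next
    case (Natrec C z s n)
    with eq obtain n' where n': "f n = Some n'" by (cases "f n") auto
    have red: "Natrec C z s n \<approx>\<^sub>\<beta> Natrec C z s n'" by (intro bc_natrec IH[OF n'] bc_refl)
    show ?thesis
    proof (cases "n' = Zero \<or> (\<exists>m. n' = Succ m)")
      case True
      then show ?thesis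
      proof (elim disjE exE)
        assume "n' = Zero"
        moreover from this Natrec eq n' have "f z = Some t'" by simp
        ultimately show ?thesis using via[OF _ bc_natrec_zero[of C z s]] red Natrec by simp
      next
        fix m assume "n' = Succ m"
        moreover from this Natrec eq n' have "f (sub2 s m (Natrec C z s m)) = Some t'"
          by (simp add: inst_simps)
        ultimately show ?thesis
          using via[OF _ bc_natrec_succ[of C z s m]] red Natrec by simp
      qed
    next
      case False
      with Natrec eq n' show ?thesis
        by (cases n') (auto simp: bind_eq_Some_conv intro: bc_natrec IH)
    qed
  next
    case (J A s C u v e)
    with eq obtain e' where e': "f e = Some e'" by (cases "f e") auto
    have red: "J A s C u v e \<approx>\<^sub>\<beta> J A s C u v e'" by (intro bc_J IH[OF e'] bc_refl)
    show ?thesis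
    proof (cases "e' = Rfl")
      case True
      moreover from this J eq e' have "f u = Some t'" by simp
      ultimately show ?thesis using via[OF _ bc_J_rfl[of A s C u v]] red J by simp
    next
      case False
      with J eq e' show ?thesis
        by (cases e') (auto simp: bind_eq_Some_conv intro: bc_J IH)
    qed
  next
    case (Unbox C b z)
    with eq obtain z' where z': "f z = Some z'" by (cases "f z") auto
    have red: "Unbox C b z \<approx>\<^sub>\<beta> Unbox C b z'" by (intro bc_unbox IH[OF z'] bc_refl)
    show ?thesis
    proof (cases "\<exists>s. z' = Box s")
      case True
      then obtain y where y: "z' = Box y" by blast
      with Unbox eq z' have "f (sub1 b y) = Some t'" by (simp add: inst_simps)
      with y show ?thesis using via[OF _ bc_unbox_box[of C b y]] red Unbox by simp
    next
      case False
      with Unbox eq z' show ?thesis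
        by (cases z') (auto simp: bind_eq_Some_conv intro: bc_unbox IH)
    qed
  qed (use eq in \<open>auto simp: bind_eq_Some_conv level_eq_lnorm intro: beta_conv.intros IH\<close>)
qed

definition conv :: "tm \<Rightarrow> tm \<Rightarrow> bool" where
  "conv t u \<longleftrightarrow> t = u \<or> (\<exists>v. nf t = Some v \<and> nf u = Some v)"

lemma conv_beta_conv: "conv t u \<Longrightarrow> t \<approx>\<^sub>\<beta> u"
  unfolding conv_def by (metis bc_refl bc_sym bc_trans nf_beta_conv)

section \<open>Synthesis and checking of types, with soundness\<close>

definition univ_of :: "tm \<Rightarrow> level option" where
  "univ_of T = (case T of Univ l \<Rightarrow> Some l | _ \<Rightarrow> None)"

definition pi_of :: "tm \<Rightarrow> (quantity \<times> tm \<times> tm) option" where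
  "pi_of T = (case T of Pi q A B \<Rightarrow> Some (q, A, B) | _ \<Rightarrow> None)"

definition lam_of :: "tm \<Rightarrow> (quantity \<times> tm) option" where
  "lam_of t = (case t of Lam q b \<Rightarrow> Some (q, b) | _ \<Rightarrow> None)"

definition sig_of :: "tm \<Rightarrow> (tm \<times> tm) option" where
  "sig_of T = (case T of Sig A B \<Rightarrow> Some (A, B) | _ \<Rightarrow> None)"

definition eq_of :: "tm \<Rightarrow> (tm \<times> tm \<times> tm) option" where
  "eq_of T = (case T of Eq A t u \<Rightarrow> Some (A, t, u) | _ \<Rightarrow> None)"

definition erased_of :: "tm \<Rightarrow> tm option" where
  "erased_of T = (case T of Erased A \<Rightarrow> Some A | _ \<Rightarrow> None)"

definition is_unit :: "tm \<Rightarrow> bool" where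
  "is_unit T = (case T of Unit l \<Rightarrow> True | _ \<Rightarrow> False)"

lemma of_eq_Some [simp]:
  "univ_of T = Some l \<longleftrightarrow> T = Univ l"
  "pi_of T = Some (q, A, B) \<longleftrightarrow> T = Pi q A B"
  "lam_of T = Some (q, t) \<longleftrightarrow> T = Lam q t"
  "sig_of T = Some (A, B) \<longleftrightarrow> T = Sig A B"
  "eq_of T = Some (A, t, u) \<longleftrightarrow> T = Eq A t u"
  "erased_of T = Some A \<longleftrightarrow> T = Erased A"
  by (auto simp: univ_of_def pi_of_def lam_of_def sig_of_def eq_of_def erased_of_def split: tm.splits)

text \<open>A \<open>\<beta>\<close>-redex has no annotation on its binder, hence its argument has to be synthesised. The type
  against which \<open>chk\<close> checks is not reduced, except for \<open>Star\<close>: subject reduction is not available, so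
  a reduct of a well-formed type is not known to be well-formed.\<close>

fun synth :: "tm list \<Rightarrow> tm \<Rightarrow> tm option" and chk :: "tm list \<Rightarrow> tm \<Rightarrow> tm \<Rightarrow> bool" where
  "synth \<Gamma> (Var i) = (if i < length \<Gamma> then Some (shift (Suc i) 0 (\<Gamma> ! i)) else None)"
| "synth \<Gamma> (Univ l) = Some (Univ (LSuc l))"
| "synth \<Gamma> (Pi q A B) = Option.bind (Option.bind (synth \<Gamma> A) univ_of) (\<lambda>k.
    Option.bind (Option.bind (synth (A # \<Gamma>) B) univ_of) (\<lambda>l. Some (Univ (LMax k l))))"
| "synth \<Gamma> (Sig A B) = Option.bind (Option.bind (synth \<Gamma> A) univ_of) (\<lambda>k.
    Option.bind (Option.bind (synth (A # \<Gamma>) B) univ_of) (\<lambda>l. Some (Univ (LMax k l))))"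
| "synth \<Gamma> (App q t u) = (case lam_of t of
      Some (q', b) \<Rightarrow>
        if q' = q
        then Option.bind (synth \<Gamma> u) (\<lambda>A.
          Option.bind (synth (A # \<Gamma>) b) (\<lambda>B. Some (inst [u] 0 0 B)))
        else None
    | None \<Rightarrow> Option.bind (Option.bind (synth \<Gamma> t) pi_of) (\<lambda>(q', A, B).
        if q' = q \<and> chk \<Gamma> u A then Some (inst [u] 0 0 B) else None))"
| "synth \<Gamma> (Fst t) = Option.bind (Option.bind (synth \<Gamma> t) sig_of) (\<lambda>(A, B). Some A)"
| "synth \<Gamma> (Snd t) =
    Option.bind (Option.bind (synth \<Gamma> t) sig_of) (\<lambda>(A, B). Some (inst [Fst t] 0 0 B))"
| "synth \<Gamma> (Unit l) = Some (Univ l)"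
| "synth \<Gamma> Nat = Some (Univ LZero)"
| "synth \<Gamma> Zero = Some Nat"
| "synth \<Gamma> (Succ t) = (if chk \<Gamma> t Nat then Some Nat else None)"
| "synth \<Gamma> (Natrec C z s n) = Option.bind (Option.bind (synth (Nat # \<Gamma>) C) univ_of) (\<lambda>l.
    if chk \<Gamma> z (inst [Zero] 0 0 C) \<and> chk (C # Nat # \<Gamma>) s (inst [Succ (Var 1)] 2 0 C) \<and> chk \<Gamma> n Nat
    then Some (inst [n] 0 0 C) else None)"
| "synth \<Gamma> (Eq A t u) = Option.bind (Option.bind (synth \<Gamma> A) univ_of) (\<lambda>l.
    if chk \<Gamma> t A \<and> chk \<Gamma> u A then Some (Univ l) else None)"
| "synth \<Gamma> (J A t C u v e) = Option.bind (Option.bind (synth \<Gamma> A) univ_of) (\<lambda>k.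
    if chk \<Gamma> t A
    then Option.bind
      (Option.bind (synth (Eq (shift 1 0 A) (shift 1 0 t) (Var 0) # A # \<Gamma>) C) univ_of) (\<lambda>l.
        if chk \<Gamma> u (inst [Rfl, t] 0 0 C) \<and> chk \<Gamma> v A \<and> chk \<Gamma> e (Eq A t v)
        then Some (inst [e, v] 0 0 C) else None)
    else None)"
| "synth \<Gamma> (Erased A) = Option.bind (Option.bind (synth \<Gamma> A) univ_of) (\<lambda>l. Some (Univ l))"
| "synth \<Gamma> (Box t) = Option.bind (synth \<Gamma> t) (\<lambda>A. Some (Erased A))"
| "synth \<Gamma> (Unbox C b z) = Option.bind (Option.bind (synth \<Gamma> z) erased_of) (\<lambda>A.
    Option.bind (Option.bind (synth (Erased A # \<Gamma>) C) univ_of) (\<lambda>l.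
      if chk (A # \<Gamma>) b (inst [Box (Var 0)] 1 0 C) then Some (inst [z] 0 0 C) else None))"
| "synth \<Gamma> t = None"
| "chk \<Gamma> (Lam q t) T =
    (case pi_of T of Some (q', A, B) \<Rightarrow> q' = q \<and> chk (A # \<Gamma>) t B | None \<Rightarrow> False)"
| "chk \<Gamma> (MkSig t u) T =
    (case sig_of T of Some (A, B) \<Rightarrow> chk \<Gamma> t A \<and> chk \<Gamma> u (inst [t] 0 0 B) | None \<Rightarrow> False)"
| "chk \<Gamma> Star T = (case nf T of Some T' \<Rightarrow> is_unit T' | None \<Rightarrow> False)"
| "chk \<Gamma> Rfl T = (case eq_of T of Some (A, t, u) \<Rightarrow> conv t u | None \<Rightarrow> False)"
| "chk \<Gamma> (Box t) T = (case erased_of T of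
      Some A \<Rightarrow> chk \<Gamma> t A
    | None \<Rightarrow> (case synth \<Gamma> t of Some A \<Rightarrow> conv (Erased A) T | None \<Rightarrow> False))"
| "chk \<Gamma> (App q t u) T = (case lam_of t of
      Some (q', b) \<Rightarrow> q' = q \<and>
        (case synth \<Gamma> u of Some A \<Rightarrow> chk (A # \<Gamma>) b (shift 1 0 T) | None \<Rightarrow> False)
    | None \<Rightarrow> (case synth \<Gamma> (App q t u) of Some A \<Rightarrow> conv A T | None \<Rightarrow> False))"
| "chk \<Gamma> t T = (case synth \<Gamma> t of Some A \<Rightarrow> conv A T | None \<Rightarrow> False)"

text \<open>Used at \<open>(t, Rfl)\<close> for the type of the branch of J and at
  \<open>(v, e)\<close> for the type of the result.\<close>

lemma typing_sub2:
  assumes "\<Gamma> \<turnstile> t \<^bold>: A" "\<Gamma> \<turnstile> v \<^bold>: A" "\<Gamma> \<turnstile> e \<^bold>: Eq A t v"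
    and "Eq (lift A) (lift t) (Var 0) # A # \<Gamma> \<turnstile> C \<^bold>: Univ l"
  shows "\<Gamma> \<turnstile> sub2 C v e \<^bold>: Univ l"
proof -
  have "sub_typing \<Gamma> (case_nat e (case_nat v Var)) (Eq (lift A) (lift t) (Var 0) # A # \<Gamma>)"
    using assms by (intro sub_typing_case_nat sub_typing_Var) (simp_all add: sub_lift2)
  from typing_sub[OF assms(4) this] show ?thesis by simp
qed

text \<open>\<open>chk\<close> is sound only for well-formed types, so the types expected of the
  branches of \<open>Unbox\<close> and \<open>Natrec\<close> must be seen to be types.\<close>

lemma typing_motives:
  assumes "\<Gamma> \<turnstile> A \<^bold>: Univ k"
  shows "Erased A # \<Gamma> \<turnstile> C \<^bold>: Univ l \<Longrightarrow> A # \<Gamma> \<turnstile> sub (case_nat (Box (Var 0)) (\<lambda>i. Var (i + 1))) C \<^bold>: Univ l"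
    and "Nat # \<Gamma> \<turnstile> C \<^bold>: Univ l \<Longrightarrow>
      C # Nat # \<Gamma> \<turnstile> sub (case_nat (Succ (Var 1)) (\<lambda>i. Var (i + 2))) C \<^bold>: Univ l"
proof -
  have "A # \<Gamma> \<turnstile> Box (Var 0) \<^bold>: Erased (sub (\<lambda>i. Var (Suc i)) A)"
    using t_box[OF typing_var[of 0 "A # \<Gamma>"]] by (simp add: ren_as_sub o_def)
  then have "sub_typing (A # \<Gamma>) (case_nat (Box (Var 0)) (\<lambda>i. Var (i + 1))) (Erased A # \<Gamma>)"
    by (intro sub_typing_case_nat) (simp_all add: sub_typing_shift)
  from typing_sub[OF _ this]
  show "Erased A # \<Gamma> \<turnstile> C \<^bold>: Univ l \<Longrightarrow> A # \<Gamma> \<turnstile> sub (case_nat (Box (Var 0)) (\<lambda>i. Var (i + 1))) C \<^bold>: Univ l"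
    by fastforce
  have "C # Nat # \<Gamma> \<turnstile> Succ (Var 1) \<^bold>: Nat"
    using t_succ typing_var[of 1 "C # Nat # \<Gamma>"] by simp
  then have "sub_typing (C # Nat # \<Gamma>) (case_nat (Succ (Var 1)) (\<lambda>i. Var (i + 2))) (Nat # \<Gamma>)"
    by (intro sub_typing_case_nat) (simp_all add: sub_typing_shift2)
  from typing_sub[OF _ this]
  show "Nat # \<Gamma> \<turnstile> C \<^bold>: Univ l \<Longrightarrow>
      C # Nat # \<Gamma> \<turnstile> sub (case_nat (Succ (Var 1)) (\<lambda>i. Var (i + 2))) C \<^bold>: Univ l"
    by fastforce
qed

lemma shift_simps: "shift (Suc i) 0 A = ren (\<lambda>j. j + Suc i) A" "shift 1 0 A = lift A"
  by (simp_all add: shift_ren)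

text \<open>The switch from checking to synthesis: \<open>t_conv_beta\<close> accepts raw
  conversion, given that the target \<open>T\<close> is a type.\<close>

lemma chk_synth:
  assumes "wf_ctx \<Gamma>" "\<Gamma> \<turnstile> T \<^bold>: Univ l" "(case synth \<Gamma> t of Some A \<Rightarrow> conv A T | None \<Rightarrow> False)"
    and "\<And>A. wf_ctx \<Gamma> \<Longrightarrow> synth \<Gamma> t = Some A \<Longrightarrow> \<Gamma> \<turnstile> t \<^bold>: A \<and> (\<exists>l. \<Gamma> \<turnstile> A \<^bold>: Univ l)"
  shows "\<Gamma> \<turnstile> t \<^bold>: T"
  using assms by (auto split: option.splits intro: t_conv_beta conv_beta_conv)

text \<open>Well-formedness of types is an output of synthesis and an input of checking. Inversion
  for type formers hands it on to components, and stability under substitution to instances, which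
  replaces subject reduction.\<close>

lemma synth_chk_sound:
  "wf_ctx \<Gamma> \<Longrightarrow> synth \<Gamma> t = Some A \<Longrightarrow> \<Gamma> \<turnstile> t \<^bold>: A \<and> (\<exists>l. \<Gamma> \<turnstile> A \<^bold>: Univ l)"
  "wf_ctx \<Gamma> \<Longrightarrow> \<Gamma> \<turnstile> T \<^bold>: Univ l \<Longrightarrow> chk \<Gamma> t T \<Longrightarrow> \<Gamma> \<turnstile> t \<^bold>: T"
proof (induction \<Gamma> t and \<Gamma> t T arbitrary: A and l rule: synth_chk.induct)
  case (1 \<Gamma> i)
  then show ?case using wf_ctx_type[of \<Gamma> i] typing_var[of i \<Gamma>]
    by (simp add: ctx_type_def shift_simps split: if_splits)
next
  case (3 \<Gamma> q A B)
  then show ?case by (fastforce simp: bind_eq_Some_conv intro: t_pi t_univ wf_Cons)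
next
  case (4 \<Gamma> A B)
  then show ?case by (fastforce simp: bind_eq_Some_conv intro: t_sig t_univ wf_Cons)
next
  case (5 \<Gamma> q t u)
  note wf = "5.prems"(1)
  show ?case
  proof (cases "lam_of t")
    case (Some r)
    with "5.prems" obtain b A' B where r: "r = (q, b)" and u: "synth \<Gamma> u = Some A'"
      and b: "synth (A' # \<Gamma>) b = Some B" and A: "A = sub1 B u"
      by (cases r) (auto simp: bind_eq_Some_conv inst_simps split: if_splits)
    with Some have t: "t = Lam q b" by simp
    from "5.IH"(3)[OF Some r[symmetric] refl wf u] obtain k
      where u': "\<Gamma> \<turnstile> u \<^bold>: A'" "\<Gamma> \<turnstile> A' \<^bold>: Univ k" by blast
    from "5.IH"(4)[OF Some r[symmetric] refl u wf_Cons[OF wf u'(2)] b] obtain l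
      where b': "A' # \<Gamma> \<turnstile> b \<^bold>: B" "A' # \<Gamma> \<turnstile> B \<^bold>: Univ l" by blast
    show ?thesis
      using t_app[OF t_lam[OF u'(2) b'(1)] u'(1)] typing_sub1[OF b'(2) u'(1)] t A by auto
  next
    case None
    with "5.prems" obtain A' B where t: "synth \<Gamma> t = Some (Pi q A' B)" and u: "chk \<Gamma> u A'"
      and A: "A = sub1 B u"
      by (auto simp: bind_eq_Some_conv inst_simps split: if_splits)
    from "5.IH"(1)[OF None wf t] have t': "\<Gamma> \<turnstile> t \<^bold>: Pi q A' B"
      and "\<exists>l. \<Gamma> \<turnstile> Pi q A' B \<^bold>: Univ l" by auto
    then obtain k l where A': "\<Gamma> \<turnstile> A' \<^bold>: Univ k" and B: "A' # \<Gamma> \<turnstile> B \<^bold>: Univ l"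
      using typing_PiD by blast
    have "Option.bind (synth \<Gamma> t) pi_of = Some (q, A', B)" using t by simp
    from "5.IH"(2)[OF None this refl refl wf A' u] have "\<Gamma> \<turnstile> u \<^bold>: A'" .
    from t_app[OF t' this] typing_sub1[OF B this] A show ?thesis by auto
  qed
next
  case (6 \<Gamma> t)
  then show ?case by (fastforce simp: bind_eq_Some_conv intro: t_fst dest: typing_SigD)
next
  case (7 \<Gamma> t)
  then obtain A' B where "synth \<Gamma> t = Some (Sig A' B)" and A: "A = sub1 B (Fst t)"
    by (auto simp: bind_eq_Some_conv inst_simps)
  with 7 obtain l where t: "\<Gamma> \<turnstile> t \<^bold>: Sig A' B" and "\<Gamma> \<turnstile> Sig A' B \<^bold>: Univ l" by blast
  then obtain l' where "A' # \<Gamma> \<turnstile> B \<^bold>: Univ l'" using typing_SigD by blast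
  from typing_sub1[OF this t_fst[OF t]] A t_snd[OF t] show ?case by auto
next
  case (11 \<Gamma> t)
  then show ?case by (auto intro: t_succ t_nat split: if_splits)
next
  case (12 \<Gamma> C z s n)
  note wf = "12.prems"(1)
  obtain l where C: "synth (Nat # \<Gamma>) C = Some (Univ l)"
    and z: "chk \<Gamma> z (inst [Zero] 0 0 C)" and s: "chk (C # Nat # \<Gamma>) s (inst [Succ (Var 1)] 2 0 C)"
    and n: "chk \<Gamma> n Nat" and A: "A = sub1 C n"
    using "12.prems"(2) by (auto simp: bind_eq_Some_conv inst_simps simp del: One_nat_def split: if_splits)
  have wf': "wf_ctx (Nat # \<Gamma>)" using wf by (rule wf_Cons) (rule t_nat)
  from "12.IH"(1)[OF wf' C] have C': "Nat # \<Gamma> \<turnstile> C \<^bold>: Univ l" by simp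
  have C_bind: "Option.bind (synth (Nat # \<Gamma>) C) univ_of = Some l" using C by simp
  have z': "\<Gamma> \<turnstile> z \<^bold>: sub1 C Zero"
    using "12.IH"(2)[OF C_bind wf _ z] typing_sub1[OF C' t_zero] by (simp add: inst_simps)
  have s': "C # Nat # \<Gamma> \<turnstile> s \<^bold>: sub (case_nat (Succ (Var 1)) (\<lambda>i. Var (i + 2))) C"
    using "12.IH"(3)[OF C_bind wf_Cons[OF wf' C'] _ s] typing_motives(2)[OF t_nat C']
    unfolding inst_simps by blast
  have n': "\<Gamma> \<turnstile> n \<^bold>: Nat"
    by (rule "12.IH"(4)[OF C_bind wf t_nat n])
  show ?case using t_natrec[OF C' z' s' n'] typing_sub1[OF C' n'] A by auto
next
  case (13 \<Gamma> A t u)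
  then show ?case by (fastforce simp: bind_eq_Some_conv intro: t_eq t_univ split: if_splits)
next
  case (14 \<Gamma> A0 t C u v e)
  note wf = "14.prems"(1)
  let ?\<Delta> = "Eq (lift A0) (lift t) (Var 0) # A0 # \<Gamma>"
  obtain k l where A: "synth \<Gamma> A0 = Some (Univ k)" and t: "chk \<Gamma> t A0"
    and C: "synth ?\<Delta> C = Some (Univ l)" and u: "chk \<Gamma> u (inst [Rfl, t] 0 0 C)"
    and v: "chk \<Gamma> v A0" and e: "chk \<Gamma> e (Eq A0 t v)" and res: "A = sub2 C v e"
    using "14.prems"(2)
    by (auto simp: bind_eq_Some_conv inst_simps shift_simps simp del: One_nat_def split: if_splits)
  from "14.IH"(1)[OF wf A] have A': "\<Gamma> \<turnstile> A0 \<^bold>: Univ k" by simp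
  have A_bind: "Option.bind (synth \<Gamma> A0) univ_of = Some k" using A by simp
  from "14.IH"(2)[OF A_bind wf A' t] have t': "\<Gamma> \<turnstile> t \<^bold>: A0" .
  have "A0 # \<Gamma> \<turnstile> Eq (lift A0) (lift t) (Var 0) \<^bold>: Univ k"
    using typing_lift[OF A'] typing_lift[OF t'] typing_var[of 0 "A0 # \<Gamma>"] by (auto intro: t_eq)
  with wf A' have wf': "wf_ctx ?\<Delta>" by (intro wf_Cons)
  from "14.IH"(3)[OF A_bind t] wf' C have C': "?\<Delta> \<turnstile> C \<^bold>: Univ l" by (simp add: shift_simps)
  have C_bind: "Option.bind (synth (Eq (shift 1 0 A0) (shift 1 0 t) (Var 0) # A0 # \<Gamma>) C) univ_of = Some l"
    using C unfolding shift_simps by simp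
  have u': "\<Gamma> \<turnstile> u \<^bold>: sub2 C t Rfl"
    using "14.IH"(4)[OF A_bind t C_bind wf _ u] typing_sub2[OF t' t' t_rfl[OF t'] C']
    by (simp add: inst_simps)
  have v': "\<Gamma> \<turnstile> v \<^bold>: A0" by (rule "14.IH"(5)[OF A_bind t C_bind wf A' v])
  have e': "\<Gamma> \<turnstile> e \<^bold>: Eq A0 t v"
    by (rule "14.IH"(6)[OF A_bind t C_bind wf _ e]) (rule t_eq[OF A' t' v'])
  show ?case using t_J[OF A' t' C' u' v' e'] typing_sub2[OF t' v' e' C'] res by auto
next
  case (15 \<Gamma> A)
  then show ?case by (fastforce simp: bind_eq_Some_conv intro: t_erased t_univ)
next
  case (16 \<Gamma> t)
  then show ?case by (fastforce simp: bind_eq_Some_conv intro: t_erased t_box)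
next
  case (17 \<Gamma> C b z)
  note wf = "17.prems"(1)
  obtain A' l where z: "synth \<Gamma> z = Some (Erased A')" and C: "synth (Erased A' # \<Gamma>) C = Some (Univ l)"
    and b: "chk (A' # \<Gamma>) b (inst [Box (Var 0)] 1 0 C)" and A: "A = sub1 C z"
    using "17.prems"(2) by (auto simp: bind_eq_Some_conv inst_simps simp del: One_nat_def split: if_splits)
  from "17.IH"(1)[OF wf z] obtain k' where z': "\<Gamma> \<turnstile> z \<^bold>: Erased A'" and EA: "\<Gamma> \<turnstile> Erased A' \<^bold>: Univ k'"
    by blast
  then obtain k where A': "\<Gamma> \<turnstile> A' \<^bold>: Univ k" using typing_ErasedD by blast
  have z_bind: "Option.bind (synth \<Gamma> z) erased_of = Some A'" using z by simp
  from "17.IH"(2)[OF z_bind wf_Cons[OF wf EA] C] have C': "Erased A' # \<Gamma> \<turnstile> C \<^bold>: Univ l" by simp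
  have C_bind: "Option.bind (synth (Erased A' # \<Gamma>) C) univ_of = Some l" using C by simp
  have b': "A' # \<Gamma> \<turnstile> b \<^bold>: sub (case_nat (Box (Var 0)) (\<lambda>i. Var (i + 1))) C"
    using "17.IH"(3)[OF z_bind C_bind wf_Cons[OF wf A'] _ b] typing_motives(1)[OF A' C']
    unfolding inst_simps by blast
  show ?case using t_unbox[OF A' C' b' z'] typing_sub1[OF C' z'] A by auto
next
  case (19 \<Gamma> q t T)
  then show ?case by (fastforce split: option.splits dest: typing_PiD intro: t_lam wf_Cons)
next
  case (20 \<Gamma> t u T)
  then obtain A B where T: "T = Sig A B" and t: "chk \<Gamma> t A" and u: "chk \<Gamma> u (inst [t] 0 0 B)"
    by (auto simp: inst_simps split: option.splits)
  note sig = of_eq_Some(4)[THEN iffD2, OF T]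
  from "20.prems"(2)[unfolded T] obtain k l
    where A: "\<Gamma> \<turnstile> A \<^bold>: Univ k" and B: "A # \<Gamma> \<turnstile> B \<^bold>: Univ l"
    using typing_SigD by blast
  from "20.IH"(1)[OF sig refl "20.prems"(1) A t] have t': "\<Gamma> \<turnstile> t \<^bold>: A" .
  have "\<Gamma> \<turnstile> u \<^bold>: sub1 B t"
    using "20.IH"(2)[OF sig refl "20.prems"(1) _ u] typing_sub1[OF B t'] by (simp add: inst_simps)
  with T A B t' show ?case by (blast intro: t_pair)
next
  case (21 \<Gamma> T)
  \<comment> \<open>\<open>Star\<close> has the type \<open>Unit k\<close> for every
    \<open>k\<close>; conversion leads back to \<open>T\<close>, which is well-formed by assumption,
    so nothing has to be known about the typing of the normal form.\<close>
  then obtain k where "nf T = Some (Unit k)"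
    by (auto simp: is_unit_def split: option.splits tm.splits)
  with 21 show ?case by (blast intro: t_star t_conv_beta bc_sym nf_beta_conv)
next
  case (22 \<Gamma> T)
  then obtain A t u where T: "T = Eq A t u" and "conv t u" by (auto split: option.splits)
  have "\<Gamma> \<turnstile> t \<^bold>: A" using typing_EqD[OF "22.prems"(2)[unfolded T]] by simp
  \<comment> \<open>Reflexivity is taken at the left end point, and only the right end point is
    converted.\<close>
  moreover have "Eq A t t \<approx>\<^sub>\<beta> T" using T conv_beta_conv[OF \<open>conv t u\<close>] by (auto intro: bc_eq bc_refl)
  ultimately show ?case using "22.prems"(2)
    by (blast intro: t_rfl t_conv_beta)
next
  case (23 \<Gamma> t T)
  show ?case
  proof (cases "erased_of T")
    case (Some A)
    then have T: "T = Erased A" by simp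
    with "23.prems" typing_ErasedD obtain k where "\<Gamma> \<turnstile> A \<^bold>: Univ k" by blast
    moreover have "chk \<Gamma> t A" using "23.prems"(3) Some by simp
    ultimately show ?thesis using "23.IH"(2)[OF Some "23.prems"(1)] T by (auto intro: t_box)
  next
    case None
    with "23.prems" obtain A where A: "synth \<Gamma> t = Some A" "conv (Erased A) T"
      by (auto split: option.splits)
    with "23.IH" None "23.prems" have "\<Gamma> \<turnstile> t \<^bold>: A" by blast
    with A "23.prems" show ?thesis by (blast intro: t_box t_conv_beta conv_beta_conv)
  qed
next
  case (24 \<Gamma> q t u T)
  note wf = "24.prems"(1) and T = "24.prems"(2)
  show ?case
  proof (cases "lam_of t")
    case (Some r)
    with "24.prems"(3) obtain b A where r: "r = (q, b)" and u: "synth \<Gamma> u = Some A"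
      and b: "chk (A # \<Gamma>) b (lift T)"
      by (cases r) (auto simp: shift_simps simp del: One_nat_def split: option.splits)
    with Some have t: "t = Lam q b" by simp
    from "24.IH"(2)[OF Some r[symmetric] wf u] obtain k where u': "\<Gamma> \<turnstile> u \<^bold>: A" "\<Gamma> \<turnstile> A \<^bold>: Univ k" by blast
    \<comment> \<open>A redex is checked by checking its body against the weakened \<open>T\<close>,
      so the body may be a lambda, for which no type is synthesised. Substituting the argument
      cancels the weakening.\<close>
    have "A # \<Gamma> \<turnstile> lift T \<^bold>: Univ l" using typing_lift[OF T] by simp
    from "24.IH"(3)[OF Some r[symmetric] u wf_Cons[OF wf u'(2)]] this b have "A # \<Gamma> \<turnstile> b \<^bold>: lift T"
      by (simp add: shift_simps)
    from t_app[OF t_lam[OF u'(2) this] u'(1)] t show ?thesis by (simp add: sub_lift2)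
  next
    case None
    with "24.prems"(3) obtain A where "synth \<Gamma> (App q t u) = Some A" "conv A T"
      by (auto simp del: synth.simps split: option.splits)
    with "24.IH"(1)[OF None wf] T show ?thesis by (blast intro: t_conv_beta conv_beta_conv)
  qed
qed ((rule chk_synth, assumption, assumption, simp only: chk.simps, blast)
  | fastforce intro: t_univ t_unit t_nat t_zero)+

section \<open>Evaluation of the checker\<close>

text \<open>As a congruence rule it restricts evaluation to the first argument; the continuation
  waits until a value is known.\<close>

lemma bind_cong_weak: "m = m' \<Longrightarrow> Option.bind m f = Option.bind m' f"
  by simp

lemma of_simps:
  "univ_of (Univ l) = Some l"
  "pi_of (Pi q A B) = Some (q, A, B)"
  "lam_of (Lam q t) = Some (q, t)"
  "sig_of (Sig A B) = Some (A, B)"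
  "eq_of (Eq A t u) = Some (A, t, u)"
  "erased_of (Erased A) = Some A"
  "is_unit (Unit l)"
  by (simp_all add: is_unit_def)

lemma lam_of_None:
  "lam_of (Var i) = None" "lam_of (App q t u) = None" "lam_of (Fst t) = None" "lam_of (Snd t) = None"
  "lam_of (Natrec C z s n) = None" "lam_of (J A t C u v e) = None" "lam_of (Unbox C b z) = None"
  by (simp_all add: lam_of_def)

lemma erased_of_None:
  "erased_of (Var i) = None" "erased_of (App q t u) = None" "erased_of (Fst t) = None" "erased_of (Snd t) = None"
  "erased_of (Natrec C z s n) = None" "erased_of (J A t C u v e) = None" "erased_of (Unbox C b z) = None"
  by (simp_all add: erased_of_def)

lemmas nf_simps =
  nf.simps[of "Var i" for i, simplified]
  nf.simps[of "Univ l" for l, simplified]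
  nf.simps[of "Pi q A B" for q A B, simplified]
  nf.simps[of "Lam q t" for q t, simplified]
  nf.simps[of "App q t u" for q t u, simplified]
  nf.simps[of "Sig A B" for A B, simplified]
  nf.simps[of "MkSig t u" for t u, simplified]
  nf.simps[of "Fst t" for t, simplified]
  nf.simps[of "Snd t" for t, simplified]
  nf.simps[of "Unit l" for l, simplified]
  nf.simps[of Star, simplified]
  nf.simps[of Nat, simplified]
  nf.simps[of Zero, simplified]
  nf.simps[of "Succ t" for t, simplified]
  nf.simps[of "Natrec C z s n" for C z s n, simplified]
  nf.simps[of "Eq A t u" for A t u, simplified]
  nf.simps[of Rfl, simplified]
  nf.simps[of "J A t C u v e" for A t C u v e, simplified]
  nf.simps[of "Erased A" for A, simplified]
  nf.simps[of "Box t" for t, simplified]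
  nf.simps[of "Unbox C b z" for C b z, simplified]

lemma conv_refl: "conv t t"
  by (simp add: conv_def)

text \<open>Replaces the existential in \<open>conv\<close>: as the premise of a conditional rewrite
  rule it is decided by evaluating both normal forms.\<close>

definition same :: "tm option \<Rightarrow> tm option \<Rightarrow> bool" where
  "same x y \<longleftrightarrow> (\<exists>v. x = Some v \<and> y = Some v)"

lemma same_Some: "same (Some t) (Some u) \<longleftrightarrow> t = u"
  by (auto simp: same_def)

lemma conv_nf: "same (nf t) (nf u) \<Longrightarrow> conv t u"
  by (auto simp: conv_def same_def)

text \<open>With an arbitrary level \<open>a\<close> the term \<open>lnorm a\<close> stays symbolic,
  and normalising a term again must leave it unchanged.\<close>

lemma lnorm_lnorm: "lnorm (lnorm l) = lnorm l"
  by (induction l) simp_all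

lemmas nat_eval = list.size(3,4) nth_Cons_0 nth_Cons_Suc Suc_less_eq zero_less_Suc not_less_zero
  diff_Suc_Suc minus_nat.diff_0 diff_0_eq_0 add_0 add_Suc add_0_right add_Suc_right One_nat_def
  numeral_2_eq_2

lemmas hoas_eval = nat_eval vr_def bind_def bind2_def Type_def pi_def pi0_def lam_def lam0_def
  app_def app0_def sigma_def unit_type_def nat_type_def natrec_def Id_def refl_def Jelim_def Er_def
  box_def unbox_def erased_def cong_def Is_equivalence_def Funext_def Stable_equality_E_def
  Modal_E_def Separated_E_def extendable_def Is_infty_extendable_along_def bracket_cong_1_def
  bracket_cong_2_def bracket_cong_3_def bracket_cong_4_def bracket_cong_5_def bracket_cong_6_def
  bracket_cong_7_def bracket_cong_8_def bracket_cong_9_def bracket_cong_10_def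

definition formed :: "tm \<Rightarrow> bool" where
  "formed T \<longleftrightarrow> (case Option.bind (synth [] T) univ_of of Some l \<Rightarrow> True | None \<Rightarrow> False)"

definition checks :: "tm \<Rightarrow> tm \<Rightarrow> bool" where
  "checks t T \<longleftrightarrow> formed T \<and> chk [] t T \<and> erasure_ok [] t"

lemma formed_typing: "formed T \<Longrightarrow> \<exists>l. [] \<turnstile> T \<^bold>: Univ l"
  using synth_chk_sound(1)[OF wf_Nil, of T]
  by (auto simp: formed_def bind_eq_Some_conv split: option.splits)

lemma inhabitedI:
  assumes "checks (t 0) (T 0)"
  shows "inhabited T"
proof -
  obtain l where "[] \<turnstile> T 0 \<^bold>: Univ l" using assms formed_typing[of "T 0"] by (auto simp: checks_def)
  from synth_chk_sound(2)[OF wf_Nil this] assms show ?thesis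
    by (auto simp: checks_def inhabited_def)
qed

lemmas checks_eval = checks_def formed_def erasure_ok.simps synth.simps chk.simps shift.simps
  inst.simps insts_def nf_simps of_simps lam_of_None erased_of_None same_Some conv_nf conv_refl
  lnorm.simps lnorm_lnorm Option.bind.simps option.case prod.case tm.case tm.inject tm.distinct
  quantity.distinct if_True if_False simp_thms nat_eval

lemmas eval_congs = bind_cong_weak option.case_cong_weak if_weak_cong tm.case_cong_weak

section \<open>Composition of closed terms\<close>

definition closed_type :: "stm \<Rightarrow> bool" where
  "closed_type T \<longleftrightarrow> (\<forall>n. T n = T 0) \<and> (\<forall>\<sigma>. sub \<sigma> (T 0) = T 0)"

text \<open>Working under one fixed hypothesis \<open>F\<close> allows modus ponens on the
  separately checked pieces, so that the checker never meets the composed term.\<close>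

definition derivable :: "stm \<Rightarrow> stm \<Rightarrow> bool" where
  "derivable F T \<longleftrightarrow> (\<exists>t. [F 0] \<turnstile> t \<^bold>: T 0 \<and> erasure_ok [Present] t)"

definition ren_erasure :: "quantity list \<Rightarrow> (nat \<Rightarrow> nat) \<Rightarrow> quantity list \<Rightarrow> bool" where
  "ren_erasure \<rho>' r \<rho> \<longleftrightarrow> (\<forall>i<length \<rho>. r i < length \<rho>' \<and> \<rho>' ! r i = \<rho> ! i)"

lemma ren_erasure_up: "ren_erasure \<rho>' r \<rho> \<Longrightarrow> ren_erasure (q # \<rho>') (up_ren r) (q # \<rho>)"
  unfolding ren_erasure_def by (auto simp: less_Suc_eq_0_disj)

lemma erasure_ok_ren:
  "\<forall>\<rho> \<rho>' r. erasure_ok \<rho> t \<longrightarrow> ren_erasure \<rho>' r \<rho> \<longrightarrow> erasure_ok \<rho>' (ren r t)"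
proof (induction t)
  case (Var i)
  then show ?case by (simp add: ren_erasure_def)
qed (simp_all, (meson ren_erasure_up)+)

lemma closed_type_arrow:
  assumes "closed_type A" "closed_type B"
  shows "closed_type (A \<rightarrow>\<^sub>t B)"
proof -
  have eqs: "A n = A 0" "B n = B 0" "sub \<sigma> (A 0) = A 0" "sub \<sigma> (B 0) = B 0" for n \<sigma>
    using assms unfolding closed_type_def by blast+
  have "(A \<rightarrow>\<^sub>t B) n = Pi Present (A 0) (B 0)" for n
    unfolding pi_def bind_def using eqs(1)[of n] eqs(2)[of "Suc n"] by simp
  then show ?thesis by (simp add: closed_type_def eqs(3,4))
qed

lemma derivable_weaken:
  assumes "inhabited T" "closed_type T"
  shows "derivable F T"
proof -
  obtain t where t: "[] \<turnstile> t \<^bold>: T 0" "erasure_ok [] t"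
    using assms(1) unfolding inhabited_def by blast
  have "lift (T 0) = T 0" using assms(2) by (simp add: closed_type_def ren_as_sub)
  with typing_lift[OF t(1), of "F 0"] have "[F 0] \<turnstile> lift t \<^bold>: T 0" by simp
  moreover have "erasure_ok [Present] (lift t)"
    using t(2) erasure_ok_ren by (fastforce simp: ren_erasure_def)
  ultimately show ?thesis unfolding derivable_def by blast
qed

lemma derivable_hyp:
  assumes "closed_type F"
  shows "derivable F F"
proof -
  have "lift (F 0) = F 0" using assms by (simp add: closed_type_def ren_as_sub)
  with typing_var[of 0 "[F 0]"] have "[F 0] \<turnstile> Var 0 \<^bold>: F 0" by simp
  then show ?thesis unfolding derivable_def by fastforce
qed

lemma derivable_mp:
  assumes "derivable F (A \<rightarrow>\<^sub>t B)" "derivable F A" "closed_type B"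
  shows "derivable F B"
proof -
  obtain t u where t: "[F 0] \<turnstile> t \<^bold>: Pi Present (A 0) (B (Suc 0))" "erasure_ok [Present] t"
    and u: "[F 0] \<turnstile> u \<^bold>: A 0" "erasure_ok [Present] u"
    using assms(1,2) unfolding derivable_def pi_def bind_def by blast
  have "sub1 (B (Suc 0)) u = B 0" using assms(3) unfolding closed_type_def by metis
  with t_app[OF t(1) u(1)] t(2) u(2) show ?thesis
    unfolding derivable_def by (metis erasure_ok.simps(5))
qed

lemma inhabited_arrow:
  assumes "[] \<turnstile> F 0 \<^bold>: Univ l" "derivable F T" "closed_type T"
  shows "inhabited (F \<rightarrow>\<^sub>t T)"
proof -
  obtain t where t: "[F 0] \<turnstile> t \<^bold>: T 0" "erasure_ok [Present] t"
    using assms(2) unfolding derivable_def by blast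
  have "T (Suc 0) = T 0" using assms(3) unfolding closed_type_def by blast
  with t_lam[OF assms(1) t(1), of Present] t(2) show ?thesis
    unfolding inhabited_def pi_def bind_def by (metis erasure_ok.simps(4))
qed

lemma derivable_mp_inhabited:
  assumes "inhabited (A \<rightarrow>\<^sub>t B)" "derivable F A" "closed_type A" "closed_type B"
  shows "derivable F B"
  using derivable_mp[OF derivable_weaken[OF assms(1)]] assms(2-) closed_type_arrow by blast

section \<open>Inhabitants of the axiomatisations\<close>

definition mk_pair :: "stm \<Rightarrow> stm \<Rightarrow> stm" where "mk_pair t u = (\<lambda>n. MkSig (t n) (u n))"

definition proj1 :: "stm \<Rightarrow> stm" where "proj1 t = (\<lambda>n. Fst (t n))"

definition proj2 :: "stm \<Rightarrow> stm" where "proj2 t = (\<lambda>n. Snd (t n))"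

definition sym_eq where "sym_eq A x y p = Jelim A x (\<lambda>z _. Id A z x) refl y p"

definition trans_eq where "trans_eq A x y z p q = Jelim A y (\<lambda>v _. Id A x v) p z q"

text \<open>The inverse law at the right end point: \<open>q\<close> backwards, then
  \<open>q\<close> forwards.\<close>

definition trans_sym where "trans_sym A x y q =
  Jelim A x (\<lambda>y q. Id (Id A y y) (trans_eq A y x y (sym_eq A x y q) q) refl) refl y q"

definition bcong where "bcong b A x y p = proj1 b \<cdot>\<^sub>0 A \<cdot>\<^sub>0 x \<cdot>\<^sub>0 y \<cdot>\<^sub>0 p"

definition bcong_refl where "bcong_refl b A x = proj2 b \<cdot>\<^sub>0 A \<cdot>\<^sub>0 x"

text \<open>The propositional eta law of \<open>Erased\<close>: on a box both sides compute to the
  same term.\<close>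

definition box_eta where "box_eta A x = unbox (\<lambda>x. Id (Er A) (box (erased A x)) x) (\<lambda>_. refl) x"

text \<open>\<open>h v q\<close> stands for the action of \<open>g\<close> on \<open>q\<close>. It is not always \<open>cong A B g u v q\<close>: for the
  identity it is \<open>q\<close>, to which \<open>cong\<close> does not reduce.\<close>

definition bcong_natural where
  "bcong_natural b A B g h u v q = Jelim A u
    (\<lambda>v q. Id (Id (Er B) (box (g u)) (box (g v))) (cong A (Er B) (\<lambda>z. box (g z)) u v q)
      (bcong b B (g u) (g v) (h v q)))
    (sym_eq (Id (Er B) (box (g u)) (box (g u))) (bcong b B (g u) (g u) refl) refl
      (bcong_refl b B (g u))) v q"

text \<open>The inverse and the left inverse law from \<open>Modal_E A\<close>.
  \<open>term_7\<close> extracts these two components from a proof of modality.\<close>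

definition Retract_E where "Retract_E A = sigma (Er A \<rightarrow>\<^sub>t A) (\<lambda>s. pi A (\<lambda>x. Id A (s \<cdot> box x) x))"

definition Stable_refl_E where "Stable_refl_E A = sigma (Stable_equality_E A)
   (\<lambda>k. pi A (\<lambda>x. Id (Id A x x) (k \<cdot> x \<cdot> x \<cdot> box refl) refl))"

text \<open>The pointwise proof is the identity function: at \<open>p\<close> of type
  \<open>[x] \<equiv> [y]\<close> the two constant functions are identified by \<open>p\<close>
  itself. \<open>A\<close>, \<open>x\<close>, \<open>y\<close> and \<open>eq\<close> occur only
  below \<open>Er\<close> and \<open>box\<close>, hence may all be erased.\<close>

definition bcong_raw where
  "bcong_raw fe A x y eq =
    (let D = Id (Er A) (box x) (box y); F = D \<rightarrow>\<^sub>t Er A;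
         f = lam (\<lambda>_. box x); g = lam (\<lambda>_. box y) in
     cong F (Er A) (\<lambda>f. box (erased A (f \<cdot> cong A (Er A) box x y eq))) f g
       (fe \<cdot> D \<cdot> Er A \<cdot> f \<cdot> g \<cdot> lam (\<lambda>p. p)))"

definition term_1 where
  "term_1 = lam (\<lambda>fe. mk_pair
     (lam0 (\<lambda>A. lam0 (\<lambda>x. lam0 (\<lambda>y. lam0 (\<lambda>eq.
        trans_eq (Er A) (box x) (box x) (box y)
          (sym_eq (Er A) (box x) (box x) (bcong_raw fe A x x refl)) (bcong_raw fe A x y eq))))))
     (lam0 (\<lambda>A. lam0 (\<lambda>x. trans_sym (Er A) (box x) (box x) (bcong_raw fe A x x refl)))))"

text \<open>For \<open>l\<close> from \<open>u\<close> to \<open>x\<close> and \<open>m\<close> from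
  \<open>v\<close> to \<open>y\<close>: the path from \<open>x\<close> to \<open>y\<close> that
  follows \<open>l\<close> backwards, then \<open>q\<close>, then \<open>m\<close>.\<close>

definition conjugate where
  "conjugate A u v x y l q m = trans_eq A x v y (trans_eq A x u v (sym_eq A u x l) q) m"

text \<open>First \<open>p\<close> is replaced by \<open>refl\<close> along \<open>r\<close>; as
  \<open>f refl\<close> computes to \<open>refl\<close> in all uses, the inverse law for
  \<open>l\<close> remains.\<close>

definition conjugate_refl where
  "conjugate_refl A u x l C f p r = trans_eq (Id A x x)
     (conjugate A u u x x l (f p) l) (conjugate A u u x x l (f refl) l) refl
     (cong C (Id A x x) (\<lambda>q. conjugate A u u x x l (f q) l) p refl r)
     (trans_sym A u x l)"

text \<open>J leaves only the case of \<open>refl\<close>, which is the computation rule in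
  \<open>w\<close>. Thus stability with this rule is a retraction of \<open>box\<close> on identity
  types.\<close>

definition stable_section where
  "stable_section A w x y p =
    Jelim A x (\<lambda>v p. Id (Id A x v) (proj1 w \<cdot> x \<cdot> v \<cdot> box p) p) (proj2 w \<cdot> x) y p"

text \<open>The form in which extensionality is consumed: the inverse map of the equivalence, at a
  constant family.\<close>

definition ext_type where
  "ext_type a = pi (Type a) (\<lambda>A. pi (Type a) (\<lambda>B. pi (A \<rightarrow>\<^sub>t B) (\<lambda>f. pi (A \<rightarrow>\<^sub>t B) (\<lambda>g.
     pi A (\<lambda>x. Id B (f \<cdot> x) (g \<cdot> x)) \<rightarrow>\<^sub>t Id (A \<rightarrow>\<^sub>t B) f g))))"

definition ext_term where
  "ext_term = lam (\<lambda>fe. lam (\<lambda>A. lam (\<lambda>B. lam (\<lambda>f. lam (\<lambda>g. lam (\<lambda>h.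
    proj1 (fe \<cdot> A \<cdot> lam (\<lambda>_. B) \<cdot> f \<cdot> g) \<cdot> h))))))"

section \<open>Stability, separatedness and modality: axiomatisations 2, 3, 6 and 7\<close>

definition term_2 where
  "term_2 = lam (\<lambda>b. mk_pair
     (lam (\<lambda>A. lam (\<lambda>x. lam (\<lambda>y. lam0 (\<lambda>eq. bcong b A x y eq)))))
     (lam (\<lambda>A. lam (\<lambda>x. bcong_refl b A x))))"

definition retract_Er_type where "retract_Er_type a = pi0 (Type a) (\<lambda>A. Retract_E (Er A))"

text \<open>The retraction flattens a doubly erased value, with \<open>erased\<close> hidden under a
  box. Applied to \<open>box x\<close> it gives \<open>box (erased A x)\<close>, so
  \<open>box_eta\<close> is the required law.\<close>

definition retract_Er_term where
  "retract_Er_term = lam0 (\<lambda>A. mk_pair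
     (lam (\<lambda>z. unbox (\<lambda>_. Er A) (\<lambda>w. box (erased A w)) z)) (lam (\<lambda>x. box_eta A x)))"

definition stable_type where "stable_type a = pi (Type a) (\<lambda>A. Retract_E A \<rightarrow>\<^sub>t Stable_refl_E A)"

definition stable_term where
  "stable_term = lam (\<lambda>b. lam (\<lambda>A. lam (\<lambda>w.
    let s = (\<lambda>z. proj1 w \<cdot> z); l = (\<lambda>x. proj2 w \<cdot> x) in
    mk_pair
      (lam (\<lambda>x. lam (\<lambda>y. lam (\<lambda>z. unbox (\<lambda>_. Id A x y) (\<lambda>p.
        conjugate A (s (box x)) (s (box y)) x y (l x)
          (cong (Er A) A s (box x) (box y) (bcong b A x y p)) (l y)) z))))
      (lam (\<lambda>x. conjugate_refl A (s (box x)) x (l x) (Id (Er A) (box x) (box x))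
        (cong (Er A) A s (box x) (box x)) (bcong b A x x refl) (bcong_refl b A x))))))"

definition separated_type where
  "separated_type a = pi (Type a) (\<lambda>A. Stable_refl_E A \<rightarrow>\<^sub>t Separated_E A)"

text \<open>At \<open>box p\<close> the right inverse law is \<open>[]-cong\<close> of the left
  inverse law at \<open>p\<close>; the coherence is then naturality with the identity for
  \<open>g\<close>.\<close>

definition separated_term where
  "separated_term = lam (\<lambda>b. lam (\<lambda>A. lam (\<lambda>w. lam (\<lambda>x. lam (\<lambda>y.
    let I = Id A x y; k = (\<lambda>z. proj1 w \<cdot> x \<cdot> y \<cdot> z) in
    mk_pair (lam k) (mk_pair
      (lam (\<lambda>z. unbox (\<lambda>z. Id (Er I) (box (k z)) z)
        (\<lambda>p. bcong b I (k (box p)) p (stable_section A w x y p)) z)) (mk_pair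
      (lam (\<lambda>e. stable_section A w x y e))
      (lam (\<lambda>e. bcong_natural b I I (\<lambda>z. z) (\<lambda>_ q. q) (k (box e)) e
        (stable_section A w x y e))))))))))"

text \<open>Retractions pass to identity types, which is what drives the induction on
  \<open>n\<close> for extendability.\<close>

definition retract_Id_type where
  "retract_Id_type a =
    pi (Type a) (\<lambda>A. Retract_E A \<rightarrow>\<^sub>t pi A (\<lambda>x. pi A (\<lambda>y. Retract_E (Id A x y))))"

definition retract_Id_term where
  "retract_Id_term = lam (\<lambda>S. lam (\<lambda>A. lam (\<lambda>w. lam (\<lambda>x. lam (\<lambda>y.
     mk_pair (proj1 (S \<cdot> A \<cdot> w) \<cdot> x \<cdot> y) (lam (\<lambda>e. stable_section A (S \<cdot> A \<cdot> w) x y e)))))))"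

definition term_3 where
  "term_3 = lam (\<lambda>R. lam (\<lambda>S. mk_pair
     (lam0 (\<lambda>A. proj1 (S \<cdot> Er A \<cdot> (R \<cdot>\<^sub>0 A)))) (lam0 (\<lambda>A. proj2 (S \<cdot> Er A \<cdot> (R \<cdot>\<^sub>0 A))))))"

definition term_6 where
  "term_6 = lam (\<lambda>R. lam (\<lambda>S. lam (\<lambda>P. lam0 (\<lambda>A. P \<cdot> Er A \<cdot> (S \<cdot> Er A \<cdot> (R \<cdot>\<^sub>0 A))))))"

definition term_7 where
  "term_7 = lam (\<lambda>b. lam (\<lambda>S. lam (\<lambda>P. mk_pair
    (lam0 (\<lambda>A. mk_pair (lam (\<lambda>z. unbox (\<lambda>_. Er A) (\<lambda>w. box (erased A w)) z)) (mk_pair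
      (lam (\<lambda>z. unbox (\<lambda>z. Id (Er (Er A)) (box (unbox (\<lambda>_. Er A) (\<lambda>w. box (erased A w)) z)) z)
         (\<lambda>w. bcong b (Er A) (box (erased A w)) w (box_eta A w)) z)) (mk_pair
      (lam (\<lambda>x. box_eta A x))
      (lam (\<lambda>x. bcong_natural b (Er A) (Er A) (\<lambda>z. z) (\<lambda>_ q. q) (box (erased A x)) x
        (box_eta A x)))))))
    (lam (\<lambda>A. lam (\<lambda>m. P \<cdot> A \<cdot> (S \<cdot> A \<cdot> mk_pair (proj1 m) (proj1 (proj2 (proj2 m))))))))))"

section \<open>Identity proofs between erased values: axiomatisations 4 and 5\<close>

definition lift_eq where
  "lift_eq b A x y p = conjugate (Er A) (box (erased A x)) (box (erased A y)) x y
     (box_eta A x) (bcong b A (erased A x) (erased A y) p) (box_eta A y)"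

text \<open>Since \<open>x\<close> and \<open>box (erased A x)\<close> agree only up to
  \<open>box_eta\<close>, \<open>lift_eq\<close> is a conjugate. No map acts on the inner loop, so
  the function passed here is the identity.\<close>

definition lift_eq_refl where
  "lift_eq_refl b A x = conjugate_refl (Er A) (box (erased A x)) x (box_eta A x)
     (Id (Er A) (box (erased A x)) (box (erased A x))) (\<lambda>q. q)
     (bcong b A (erased A x) (erased A x) refl) (bcong_refl b A (erased A x))"

definition erased_cong where "erased_cong A x y e = cong (Er A) A (erased A) x y e"

definition erased_Id where "erased_Id A x y = Id A (erased A x) (erased A y)"

definition lift_eq_left where
  "lift_eq_left b A x y e = Jelim (Er A) x
     (\<lambda>v e. Id (Id (Er A) x v) (lift_eq b A x v (erased_cong A x v e)) e)
     (lift_eq_refl b A x) y e"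

definition lift_eq_right_type where
  "lift_eq_right_type b A x y p =
    Id (erased_Id A x y) (erased_cong A x y (lift_eq b A x y p)) p"

text \<open>Matching on the end points makes them boxes, between which J can be used.\<close>

definition lift_eq_right where
  "lift_eq_right b A x y p =
    unbox (\<lambda>x. pi (erased_Id A x y) (\<lambda>p. lift_eq_right_type b A x y p)) (\<lambda>x'. lam (\<lambda>p.
      unbox (\<lambda>y. pi (erased_Id A (box x') y) (\<lambda>p. lift_eq_right_type b A (box x') y p)) (\<lambda>y'. lam (\<lambda>p.
        Jelim A x' (\<lambda>y' p. lift_eq_right_type b A (box x') (box y') p)
          (cong (Id (Er A) (box x') (box x')) (Id A x' x') (erased_cong A (box x') (box x'))
            (lift_eq b A (box x') (box x') refl) refl (lift_eq_refl b A (box x'))) y' p)) y \<cdot> p)) x \<cdot> p"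

text \<open>The coherence clause as a family in the end points and the proof, to which J and then
  matching on \<open>x\<close> can be applied.\<close>

definition lift_eq_coherence where
  "lift_eq_coherence b A x y e =
    (let Q = erased_Id A x y; g = erased_cong A x y; u = lift_eq b A x y (g e) in
     Id (Id (Er Q) (box (g u)) (box (g e)))
       (cong (Id (Er A) x y) (Er Q) (\<lambda>e. box (g e)) u e (lift_eq_left b A x y e))
       (bcong b Q (g u) (g e) (lift_eq_right b A x y (g e))))"

text \<open>For the coherence, J makes \<open>e\<close> trivial and matching makes \<open>x\<close>
  a box. There \<open>lift_eq_right\<close> computes to \<open>cong g\<close> of
  \<open>lift_eq_refl\<close>, so naturality of \<open>[]-cong\<close> for \<open>g\<close>
  applies.\<close>

definition term_5 where
  "term_5 = lam (\<lambda>b. lam0 (\<lambda>A. lam (\<lambda>x. lam (\<lambda>y.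
    let k = unbox (\<lambda>_. Id (Er A) x y) (\<lambda>p. lift_eq b A x y p);
        Q = erased_Id A x y; g = erased_cong A x y in
    mk_pair (lam k) (mk_pair
      (lam (\<lambda>z. unbox (\<lambda>z. Id (Er Q) (box (g (k z))) z)
        (\<lambda>p. bcong b Q (g (lift_eq b A x y p)) p (lift_eq_right b A x y p)) z)) (mk_pair
      (lam (\<lambda>e. lift_eq_left b A x y e))
      (lam (\<lambda>e. Jelim (Er A) x (\<lambda>y e. lift_eq_coherence b A x y e)
        (unbox (\<lambda>x. lift_eq_coherence b A x x refl) (\<lambda>x'.
          let X = box x'; I = Id (Er A) X X; Q = Id A x' x'; g = erased_cong A X X;
              u = lift_eq b A X X refl in
          bcong_natural b I Q g (\<lambda>v q. cong I Q g u v q) u refl (lift_eq_refl b A X)) x)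
        y e))))))))"

text \<open>Axiomatisation 5 at boxed end points, where \<open>erased A (box x)\<close> computes to
  \<open>x\<close>.\<close>

definition term_4 where
  "term_4 = lam (\<lambda>f. lam0 (\<lambda>A. lam0 (\<lambda>x. lam0 (\<lambda>y. f \<cdot>\<^sub>0 A \<cdot> box x \<cdot> box y))))"

section \<open>Erased substitution and erased J: axiomatisations 8 and 9\<close>

definition subst_box where
  "subst_box A x y P p q = Jelim (Er A) (box x) (\<lambda>z _. P \<cdot>\<^sub>0 erased A z) p (box y) q"

text \<open>\<open>P\<close> takes an erased argument, so \<open>erased A z\<close> may occur in the
  motive of the transport. The transport along \<open>refl\<close> computes, hence
  \<open>bcong_refl\<close> gives the computation rule.\<close>

definition term_8 where
  "term_8 = lam (\<lambda>b. mk_pair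
    (lam0 (\<lambda>A. lam0 (\<lambda>x. lam0 (\<lambda>y. lam (\<lambda>P. lam0 (\<lambda>eq. lam (\<lambda>p.
      subst_box A x y P p (bcong b A x y eq))))))))
    (lam0 (\<lambda>A. lam0 (\<lambda>x. lam (\<lambda>P. lam (\<lambda>p.
      cong (Id (Er A) (box x) (box x)) (P \<cdot>\<^sub>0 x) (subst_box A x x P p)
        (bcong b A x x refl) refl (bcong_refl b A x)))))))"

text \<open>The result lies over \<open>cong erased q\<close>; \<open>erased_bcong\<close> relates
  this proof to \<open>eq\<close>.\<close>

definition J_box where
  "J_box A x P r y q = Jelim (Er A) (box x)
     (\<lambda>z e. P \<cdot>\<^sub>0 erased A z \<cdot>\<^sub>0 erased_cong A (box x) z e) r (box y) q"

definition erased_bcong where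
  "erased_bcong b A x y eq = Jelim A x
     (\<lambda>y eq. Id (Id A x y) (erased_cong A (box x) (box y) (bcong b A x y eq)) eq)
     (cong (Id (Er A) (box x) (box x)) (Id A x x) (erased_cong A (box x) (box x))
       (bcong b A x x refl) refl (bcong_refl b A x)) y eq"

text \<open>Erased substitution in the family \<open>P y\<close> over the type
  \<open>Id A x y\<close>. The proof \<open>w\<close> is passed as an erased argument, so
  \<open>erased_bcong\<close> may use J on the erased \<open>eq\<close>.\<close>

definition subst_along where
  "subst_along c A x y P u v w r =
    proj1 c \<cdot>\<^sub>0 Id A x y \<cdot>\<^sub>0 u \<cdot>\<^sub>0 v \<cdot> lam0 (\<lambda>e. P \<cdot>\<^sub>0 y \<cdot>\<^sub>0 e) \<cdot>\<^sub>0 w \<cdot> r"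

text \<open>For the computation rule, \<open>refl\<close> is generalised to a loop \<open>v\<close>
  at \<open>[x]\<close> with a proof \<open>w\<close> of \<open>u \<equiv> v\<close>. At
  \<open>v = u\<close> the claim is the computation rule of axiomatisation 8; at \<open>refl\<close>
  with \<open>bcong_refl\<close> the term \<open>erased_bcong\<close> computes to the
  \<open>cong\<close> in the motive.\<close>

definition term_9 where
  "term_9 = lam (\<lambda>b. lam (\<lambda>c. mk_pair
    (lam0 (\<lambda>A. lam0 (\<lambda>x. lam0 (\<lambda>y. lam (\<lambda>P. lam (\<lambda>r. lam0 (\<lambda>eq.
      subst_along c A x y P (erased_cong A (box x) (box y) (bcong b A x y eq)) eq
        (erased_bcong b A x y eq) (J_box A x P r y (bcong b A x y eq)))))))))
    (lam0 (\<lambda>A. lam0 (\<lambda>x. lam (\<lambda>P. lam (\<lambda>r.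
      let D = Id (Er A) (box x) (box x); u = bcong b A x x refl; g = erased_cong A (box x) (box x) in
      Jelim D u
        (\<lambda>v w. Id (P \<cdot>\<^sub>0 x \<cdot>\<^sub>0 g v)
          (subst_along c A x x P (g u) (g v) (cong D (Id A x x) g u v w) (J_box A x P r x u))
          (J_box A x P r x v))
        (proj2 c \<cdot>\<^sub>0 Id A x x \<cdot>\<^sub>0 g u \<cdot> lam0 (\<lambda>e. P \<cdot>\<^sub>0 x \<cdot>\<^sub>0 e) \<cdot> J_box A x P r x u)
        refl (bcong_refl b A x))))))))"

section \<open>Extendability: axiomatisation 10\<close>

definition star :: stm where "star = (\<lambda>_. Star)"

definition zero :: stm where "zero = (\<lambda>_. Zero)"

text \<open>A type ascription that reduces to \<open>t\<close>: the motive of \<open>Natrec\<close> tells the checker the type.\<close>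

definition ascribe where "ascribe T t = natrec (\<lambda>_. T) t (\<lambda>_ r. r) zero"

text \<open>Induction on \<open>m\<close> for all families with fibrewise retractions of
  \<open>box\<close>: a section over boxes extends by matching followed by the retraction, and
  \<open>D\<close> passes retractions to the identity families of the next stage. The unfolded type
  is ascribed because \<open>chk\<close> does not reduce \<open>extendable\<close> at a
  successor.\<close>

definition term_10 where
  "term_10 a = lam (\<lambda>R. lam (\<lambda>D. lam (\<lambda>A. lam (\<lambda>B. lam (\<lambda>m.
    let f = lam (\<lambda>x. box x) in
    natrec
      (\<lambda>m. pi (Er A \<rightarrow>\<^sub>t Type a) (\<lambda>P.
         pi (Er A) (\<lambda>y. Retract_E (P \<cdot> y)) \<rightarrow>\<^sub>t extendable a a a A (Er A) m f P))
      (lam (\<lambda>P. lam (\<lambda>w. star)))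
      (\<lambda>m ih. lam (\<lambda>P. lam (\<lambda>w.
        ascribe
          (pi (pi A (\<lambda>x. P \<cdot> (f \<cdot> x))) (\<lambda>g.
             sigma (pi (Er A) (\<lambda>y. P \<cdot> y)) (\<lambda>h. pi A (\<lambda>x. Id (P \<cdot> (f \<cdot> x)) (h \<cdot> (f \<cdot> x)) (g \<cdot> x))))
           \<times>\<^sub>t
           pi (pi (Er A) (\<lambda>y. P \<cdot> y)) (\<lambda>g. pi (pi (Er A) (\<lambda>y. P \<cdot> y)) (\<lambda>h.
             extendable a a a A (Er A) m f (lam (\<lambda>y. Id (P \<cdot> y) (g \<cdot> y) (h \<cdot> y))))))
          (mk_pair
            (lam (\<lambda>g. mk_pair
              (lam (\<lambda>y. unbox (\<lambda>y. P \<cdot> y) (\<lambda>x. proj1 (w \<cdot> box x) \<cdot> box (g \<cdot> x)) y))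
              (lam (\<lambda>x. proj2 (w \<cdot> box x) \<cdot> (g \<cdot> x)))))
            (lam (\<lambda>g. lam (\<lambda>h. ih \<cdot> lam (\<lambda>y. Id (P \<cdot> y) (g \<cdot> y) (h \<cdot> y))
              \<cdot> lam (\<lambda>y. D \<cdot> (P \<cdot> y) \<cdot> (w \<cdot> y) \<cdot> (g \<cdot> y) \<cdot> (h \<cdot> y)))))))))
      m \<cdot> lam (\<lambda>_. Er B) \<cdot> lam (\<lambda>_. R \<cdot>\<^sub>0 B))))))"

section \<open>Running the checker on the terms\<close>

lemmas type_eval = ext_type_def retract_Er_type_def stable_type_def separated_type_def
  retract_Id_type_def Retract_E_def Stable_refl_E_def

lemmas term_eval = hoas_eval type_eval Let_def mk_pair_def proj1_def proj2_def sym_eq_def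
  trans_eq_def trans_sym_def bcong_def bcong_refl_def box_eta_def bcong_natural_def
  bcong_raw_def conjugate_def conjugate_refl_def stable_section_def ext_term_def term_1_def
  term_2_def retract_Er_term_def stable_term_def separated_term_def retract_Id_term_def
  term_3_def term_6_def term_7_def lift_eq_def lift_eq_refl_def erased_cong_def erased_Id_def
  lift_eq_left_def lift_eq_right_type_def lift_eq_right_def lift_eq_coherence_def term_5_def
  term_4_def subst_box_def term_8_def J_box_def erased_bcong_def subst_along_def term_9_def
  star_def zero_def ascribe_def term_10_def

lemma closed_types:
  "closed_type (Funext a a)" "closed_type (bracket_cong_1 a)" "closed_type (bracket_cong_2 a)"
  "closed_type (bracket_cong_3 a)" "closed_type (bracket_cong_4 a)" "closed_type (bracket_cong_5 a)"
  "closed_type (bracket_cong_6 a)" "closed_type (bracket_cong_7 a)" "closed_type (bracket_cong_8 a)"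
  "closed_type (bracket_cong_9 a)" "closed_type (bracket_cong_10 a)" "closed_type (ext_type a)"
  "closed_type (retract_Er_type a)" "closed_type (stable_type a)" "closed_type (separated_type a)"
  "closed_type (retract_Id_type a)"
  unfolding closed_type_def by (simp_all add: hoas_eval type_eval Suc_diff_le)

text \<open>Two passes: the named notation is unfolded to a de Bruijn term, and then the checker is
  evaluated on it.\<close>

lemma Funext_typing: "\<exists>l. [] \<turnstile> Funext a a 0 \<^bold>: Univ l"
  by (rule formed_typing, simp only: hoas_eval, simp only: checks_eval cong: eval_congs)

lemma inhabited_ext: "inhabited (Funext a a \<rightarrow>\<^sub>t ext_type a)"
  by (rule inhabitedI[where t = ext_term], simp only: term_eval,
    simp only: checks_eval cong: eval_congs)

lemma inhabited_one: "inhabited (ext_type a \<rightarrow>\<^sub>t bracket_cong_1 a)"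
  by (rule inhabitedI[where t = term_1], simp only: term_eval,
    simp only: checks_eval cong: eval_congs)

lemma inhabited_two: "inhabited (bracket_cong_1 a \<rightarrow>\<^sub>t bracket_cong_2 a)"
  by (rule inhabitedI[where t = term_2], simp only: term_eval,
    simp only: checks_eval cong: eval_congs)

lemma inhabited_retract_Er: "inhabited (retract_Er_type a)"
  by (rule inhabitedI[where t = retract_Er_term], simp only: term_eval,
    simp only: checks_eval cong: eval_congs)

lemma inhabited_stable: "inhabited (bracket_cong_1 a \<rightarrow>\<^sub>t stable_type a)"
  by (rule inhabitedI[where t = stable_term], simp only: term_eval,
    simp only: checks_eval cong: eval_congs)

lemma inhabited_separated: "inhabited (bracket_cong_1 a \<rightarrow>\<^sub>t separated_type a)"
  by (rule inhabitedI[where t = separated_term], simp only: term_eval,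
    simp only: checks_eval cong: eval_congs)

lemma inhabited_retract_Id: "inhabited (stable_type a \<rightarrow>\<^sub>t retract_Id_type a)"
  by (rule inhabitedI[where t = retract_Id_term], simp only: term_eval,
    simp only: checks_eval cong: eval_congs)

lemma inhabited_three: "inhabited (retract_Er_type a \<rightarrow>\<^sub>t stable_type a \<rightarrow>\<^sub>t bracket_cong_3 a)"
  by (rule inhabitedI[where t = term_3], simp only: term_eval,
    simp only: checks_eval cong: eval_congs)

lemma inhabited_six:
  "inhabited (retract_Er_type a \<rightarrow>\<^sub>t stable_type a \<rightarrow>\<^sub>t separated_type a \<rightarrow>\<^sub>t bracket_cong_6 a)"
  by (rule inhabitedI[where t = term_6], simp only: term_eval,
    simp only: checks_eval cong: eval_congs)

lemma inhabited_seven: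
  "inhabited (bracket_cong_1 a \<rightarrow>\<^sub>t stable_type a \<rightarrow>\<^sub>t separated_type a \<rightarrow>\<^sub>t bracket_cong_7 a)"
  by (rule inhabitedI[where t = term_7], simp only: term_eval,
    simp only: checks_eval cong: eval_congs)

lemma inhabited_five: "inhabited (bracket_cong_1 a \<rightarrow>\<^sub>t bracket_cong_5 a)"
  by (rule inhabitedI[where t = term_5], simp only: term_eval,
    simp only: checks_eval cong: eval_congs)

lemma inhabited_four: "inhabited (bracket_cong_5 a \<rightarrow>\<^sub>t bracket_cong_4 a)"
  by (rule inhabitedI[where t = term_4], simp only: term_eval,
    simp only: checks_eval cong: eval_congs)

lemma inhabited_eight: "inhabited (bracket_cong_1 a \<rightarrow>\<^sub>t bracket_cong_8 a)"
  by (rule inhabitedI[where t = term_8], simp only: term_eval,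
    simp only: checks_eval cong: eval_congs)

lemma inhabited_nine: "inhabited (bracket_cong_1 a \<rightarrow>\<^sub>t bracket_cong_8 a \<rightarrow>\<^sub>t bracket_cong_9 a)"
  by (rule inhabitedI[where t = term_9], simp only: term_eval,
    simp only: checks_eval cong: eval_congs)

lemma inhabited_ten: "inhabited (retract_Er_type a \<rightarrow>\<^sub>t retract_Id_type a \<rightarrow>\<^sub>t bracket_cong_10 a)"
  by (rule inhabitedI[where t = "term_10 a"], simp only: term_eval,
    simp only: checks_eval cong: eval_congs)

theorem theorem16p2:
  fixes a :: level and T :: stm
  assumes "T \<in> bracket_cong_axiomatisations a"
  shows "inhabited (Funext a a \<rightarrow>\<^sub>t T)"
proof -
  \<comment> \<open>Everything is derived under the hypothesis \<open>Funext a a\<close>; the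
    function type is introduced once, at the end.\<close>
  let ?d = "derivable (Funext a a)"
  have "?d (ext_type a)"
    by (rule derivable_mp_inhabited[OF inhabited_ext derivable_hyp]) (rule closed_types)+
  then have one: "?d (bracket_cong_1 a)"
    by (rule derivable_mp_inhabited[OF inhabited_one]) (rule closed_types)+
  have retract: "?d (retract_Er_type a)"
    by (rule derivable_weaken[OF inhabited_retract_Er]) (rule closed_types)
  have stable: "?d (stable_type a)" and separated: "?d (separated_type a)"
    using derivable_mp_inhabited[OF inhabited_stable one]
      derivable_mp_inhabited[OF inhabited_separated one]
    by (simp_all add: closed_types)
  have retract_Id: "?d (retract_Id_type a)"
    by (rule derivable_mp_inhabited[OF inhabited_retract_Id stable]) (rule closed_types)+
  have two: "?d (bracket_cong_2 a)" and five: "?d (bracket_cong_5 a)" and eight: "?d (bracket_cong_8 a)"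
    using derivable_mp_inhabited[OF inhabited_two one] derivable_mp_inhabited[OF inhabited_five one]
      derivable_mp_inhabited[OF inhabited_eight one]
    by (simp_all add: closed_types)
  have four: "?d (bracket_cong_4 a)"
    by (rule derivable_mp_inhabited[OF inhabited_four five]) (rule closed_types)+
  have three: "?d (bracket_cong_3 a)"
    using derivable_mp[OF derivable_mp_inhabited[OF inhabited_three retract] stable]
    by (simp add: closed_types closed_type_arrow)
  have six: "?d (bracket_cong_6 a)"
    using derivable_mp[OF derivable_mp[OF
      derivable_mp_inhabited[OF inhabited_six retract] stable] separated]
    by (simp add: closed_types closed_type_arrow)
  have seven: "?d (bracket_cong_7 a)"
    using derivable_mp[OF derivable_mp[OF
      derivable_mp_inhabited[OF inhabited_seven one] stable] separated]
    by (simp add: closed_types closed_type_arrow)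
  have nine: "?d (bracket_cong_9 a)"
    using derivable_mp[OF derivable_mp_inhabited[OF inhabited_nine one] eight]
    by (simp add: closed_types closed_type_arrow)
  have ten: "?d (bracket_cong_10 a)"
    using derivable_mp[OF derivable_mp_inhabited[OF inhabited_ten retract] retract_Id]
    by (simp add: closed_types closed_type_arrow)
  have "?d T" "closed_type T"
    using assms one two three four five six seven eight nine ten
    unfolding bracket_cong_axiomatisations_def by (auto simp: closed_types)
  with Funext_typing[of a] inhabited_arrow show ?thesis by blast
qed

end
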